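(* Let $p > 6949$ be a prime. If $x, y \in \mathbb{Z}$ satisfy $x^2 - 2 = y^p$, then $y = -1$. *)

theory Defs
  imports Main "HOL-Computational_Algebra.Primes"
begin

end

theory Submission
  imports Defs "HOL-Complex_Analysis.Complex_Analysis" "Jordan_Normal_Form.Determinant"
begin

text \<open>
  Suppose \<open>y \<noteq> -1\<close>; congruences modulo 8 give \<open>y \<ge> 7\<close>. In \<open>\<int>[\<surd>2]\<close> one has
  \<open>x + \<surd>2 = \<plusminus>(1 + \<surd>2)\<^sup>n \<beta>\<^sup>p\<close> with \<open>\<beta>\<close> of norm \<open>\<plusminus>y\<close> and \<open>2 \<bar>n\<bar> < p\<close>. Put
  \<open>\<alpha>\<^sub>1 = (1 + \<surd>2)\<^sup>2 = e\<^bsup>\<theta>\<^sub>1\<^esup>\<close> and \<open>\<alpha>\<^sub>2 = \<beta>\<^sup>2 / y = e\<^bsup>\<theta>\<^esup>\<close>; the conjugate of each is its inverse. Replacing \<open>\<theta>\<close> by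
  \<open>-\<theta>\<close> if necessary, \<open>p \<theta> - b \<theta>\<^sub>1\<close> with \<open>b = \<bar>n\<bar>\<close> is at most \<open>4 y\<^bsup>-p/2\<^esup>\<close> in absolute value. This is refuted
  by Laurent's method of interpolation determinants: consider the functions
  \<open>binomial(r p + s b, k) \<alpha>\<^sub>1\<^bsup>l r\<^esup> \<alpha>\<^sub>2\<^bsup>l s\<^esup>\<close> with \<open>k < K\<close> and \<open>\<bar>l\<bar> \<le> H\<close> on a symmetric box of points \<open>(r, s)\<close>.
  A zero estimate provides a nonvanishing minor. Since the range of \<open>l\<close> is symmetric, conjugation
  maps this minor to plus or minus itself, so apart from a power of \<open>y\<close> in the denominator its absolute
  value is at least 1. On the other hand, since the linear form is tiny, the minor is close to one made
  of values of entire functions of one variable, and the Schwarz lemma bounds it from above.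
  With \<open>L = 2 H + 1\<close> about \<open>ln p + 3\<close>, with \<open>2 a + 1\<close> about \<open>3/2 L ln y\<close>, \<open>K = 5 (2 a + 1)\<close>, \<open>\<bar>r\<bar> \<le> a + H\<close>,
  \<open>\<bar>s\<bar> \<le> 5 H + 2\<close> and radius \<open>6\<close>, the two bounds contradict each other as soon as \<open>p > 6949\<close>.
\<close>

section \<open>Determinants of function values\<close>

text \<open>Entries as functions of two indices let them be rewritten pointwise, without matrix
  carriers.\<close>

abbreviation fdet :: "nat \<Rightarrow> (nat \<Rightarrow> nat \<Rightarrow> 'a) \<Rightarrow> 'a::comm_ring_1" where
  "fdet n F \<equiv> Determinant.det (Matrix.mat n n (\<lambda>(i, j). F i j))"

lemma fdet_expand:
  "fdet n F = (\<Sum>\<sigma> | \<sigma> permutes {0..<n}. of_int (sign \<sigma>) * (\<Prod>i=0..<n. F i (\<sigma> i)))"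
proof -
  have "fdet n F = (\<Sum>\<sigma> | \<sigma> permutes {0..<n}. of_int (sign \<sigma>)
      * (\<Prod>i=0..<n. Matrix.mat n n (\<lambda>(i, j). F i j) $$ (i, \<sigma> i)))"
    by (rule det_def') simp
  also have "\<dots> = (\<Sum>\<sigma> | \<sigma> permutes {0..<n}. of_int (sign \<sigma>) * (\<Prod>i=0..<n. F i (\<sigma> i)))"
  proof (intro sum.cong refl arg_cong2[where f = "(*)"] prod.cong)
    fix \<sigma> i assume "\<sigma> \<in> {\<sigma>. \<sigma> permutes {0..<n}}" "i \<in> {0..<n}"
    moreover from this have "\<sigma> i < n"
      using permutes_in_image by fastforce
    ultimately show "Matrix.mat n n (\<lambda>(i, j). F i j) $$ (i, \<sigma> i) = F i (\<sigma> i)"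
      by simp
  qed
  finally show ?thesis .
qed

lemma fdet_cong:
  assumes "\<And>i j. i < n \<Longrightarrow> j < n \<Longrightarrow> F i j = G i j"
  shows "fdet n F = fdet n G"
  by (rule arg_cong[where f = Determinant.det]) (auto simp: assms intro!: eq_matI)

lemma fdet_transpose: "fdet n (\<lambda>i j. F j i) = fdet n F"
proof -
  have "Matrix.mat n n (\<lambda>(i, j). F j i) = transpose_mat (Matrix.mat n n (\<lambda>(i, j). F i j))"
    by (auto intro!: eq_matI)
  thus ?thesis
    using det_transpose[of "Matrix.mat n n (\<lambda>(i, j). F i j)" n] by simp
qed

lemma fdet_permute_rows:
  assumes "\<sigma> permutes {0..<n}"
  shows "fdet n (\<lambda>i j. F (\<sigma> i) j) = of_int (sign \<sigma>) * fdet n F"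
proof -
  have "fdet n (\<lambda>i j. F (\<sigma> i) j)
      = Determinant.det (Matrix.mat n n (\<lambda>(i, j). Matrix.mat n n (\<lambda>(i, j). F i j) $$ (\<sigma> i, j)))"
    using assms permutes_in_image[OF assms]
    by (intro arg_cong[where f = Determinant.det] eq_matI) auto
  thus ?thesis
    using det_permute_rows[OF _ assms, of "Matrix.mat n n (\<lambda>(i, j). F i j)"] by simp
qed

lemma fdet_permute_cols:
  assumes "\<sigma> permutes {0..<n}"
  shows "fdet n (\<lambda>i j. F i (\<sigma> j)) = of_int (sign \<sigma>) * fdet n F"
  using fdet_permute_rows[OF assms, of "\<lambda>i j. F j i"]
    fdet_transpose[of n "\<lambda>i j. F i (\<sigma> j)"] fdet_transpose[of n F] by simp

lemma fdet_scale_rows: "fdet n (\<lambda>i j. c i * F i j) = (\<Prod>i=0..<n. c i) * fdet n F"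
  unfolding fdet_expand sum_distrib_left
  by (intro sum.cong refl) (simp add: prod.distrib mult_ac)

lemma fdet_eq_rows:
  assumes "i < n" "j < n" "i \<noteq> j" "\<And>k. k < n \<Longrightarrow> F i k = F j k"
  shows "fdet n F = 0"
  by (rule det_identical_rows[of _ n i j]) (use assms in \<open>auto intro!: eq_vecI\<close>)

text \<open>Multilinearity in the rows: a choice function picks one summand per row. Fixing it to
  the identity outside the index range makes the set of choice functions finite.\<close>

lemma fdet_sum_rows:
  assumes "finite S"
  shows "fdet n (\<lambda>i j. \<Sum>s\<in>S. a i s j)
    = (\<Sum>f | (\<forall>i\<in>{0..<n}. f i \<in> S) \<and> (\<forall>i. i \<notin> {0..<n} \<longrightarrow> f i = i). fdet n (\<lambda>i j. a i (f i) j))"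
proof -
  have *: "Matrix.mat n n (\<lambda>(i, j). G i j) = mat\<^sub>r n n (\<lambda>i. vec n (G i))" for G :: "nat \<Rightarrow> nat \<Rightarrow> 'a"
    by (auto intro!: eq_matI)
  have **: "vec n (\<lambda>j. \<Sum>s\<in>S. a i s j) = finsum_vec TYPE('a) n (\<lambda>s. vec n (a i s)) S" for i
  proof -
    have "finsum_vec TYPE('a) n (\<lambda>s. vec n (a i s)) S \<in> carrier_vec n"
      by (intro finsum_vec_closed) auto
    thus ?thesis
      by (intro eq_vecI) (auto simp: index_finsum_vec[OF assms])
  qed
  show ?thesis
    unfolding * ** by (rule det_linear_rows_sum[OF assms]) auto
qed

section \<open>Nonvanishing minors and Vandermonde determinants\<close>

text \<open>A nonvanishing minor grows by one row at a time: expanded along a new row at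
  \<open>x\<close>, the larger determinant is a linear combination of the \<open>g j x\<close> whose
  last coefficient is the old minor. Linear independence on \<open>E\<close> then supplies a
  suitable \<open>x\<close>.\<close>

lemma exists_nonzero_minor:
  fixes g :: "nat \<Rightarrow> 'b \<Rightarrow> 'a::field"
  assumes "\<And>c. (\<exists>j<n. c j \<noteq> 0) \<Longrightarrow> \<exists>x\<in>E. (\<Sum>j<n. c j * g j x) \<noteq> 0"
  shows "\<exists>P. (\<forall>i<n. P i \<in> E) \<and> fdet n (\<lambda>i j. g j (P i)) \<noteq> 0"
  using assms
proof (induction n)
  case 0
  show ?case by (auto simp: fdet_expand)
next
  case (Suc n)
  have "\<exists>P. (\<forall>i<n. P i \<in> E) \<and> fdet n (\<lambda>i j. g j (P i)) \<noteq> 0"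
  proof (rule Suc.IH)
    fix c :: "nat \<Rightarrow> 'a" assume c: "\<exists>j<n. c j \<noteq> 0"
    \<comment> \<open>Independence of the first \<open>n\<close> functions follows by extending the
      coefficients with a zero.\<close>
    have "\<exists>x\<in>E. (\<Sum>j<Suc n. (c(n := 0)) j * g j x) \<noteq> 0"
      using c by (intro Suc.prems) (auto simp: less_Suc_eq)
    thus "\<exists>x\<in>E. (\<Sum>j<n. c j * g j x) \<noteq> 0" by simp
  qed
  then obtain P where P: "\<And>i. i < n \<Longrightarrow> P i \<in> E" "fdet n (\<lambda>i j. g j (P i)) \<noteq> 0"
    by blast
  define A where "A x = Matrix.mat (Suc n) (Suc n) (\<lambda>(i, j). g j ((P(n := x)) i))" for x
  have del: "mat_delete (A x) n j = Matrix.mat n n (\<lambda>(i, j'). g (insert_index j j') (P i))"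
    if "j \<le> n" for x j
    using that by (auto simp: mat_delete_def A_def insert_index_def intro!: eq_matI)
  define c where "c j = (-1) ^ (n + j) * Determinant.det (Matrix.mat n n (\<lambda>(i, j'). g (insert_index j j') (P i)))" for j
  have det: "Determinant.det (A x) = (\<Sum>j<Suc n. c j * g j x)" for x
  proof -
    have "Determinant.det (A x) = (\<Sum>j<Suc n. A x $$ (n, j) * cofactor (A x) n j)"
      by (rule laplace_expansion_row) (auto simp: A_def)
    also have "\<dots> = (\<Sum>j<Suc n. c j * g j x)"
    proof (intro sum.cong refl)
      fix j assume j: "j \<in> {..<Suc n}"
      have "A x $$ (n, j) = g j x"
        using j by (simp add: A_def)
      moreover have "cofactor (A x) n j = c j"
        using j by (simp add: cofactor_def c_def del)
      ultimately show "A x $$ (n, j) * cofactor (A x) n j = c j * g j x"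
        by simp
    qed
    finally show ?thesis .
  qed
  have "Matrix.mat n n (\<lambda>(i, j'). g (insert_index n j') (P i)) = Matrix.mat n n (\<lambda>(i, j). g j (P i))"
    by (auto simp: insert_index_def intro!: eq_matI)
  hence "c n \<noteq> 0"
    using P(2) by (simp add: c_def)
  then obtain x where x: "x \<in> E" "(\<Sum>j<Suc n. c j * g j x) \<noteq> 0"
    using Suc.prems[of c] by blast
  have "fdet (Suc n) (\<lambda>i j. g j ((P(n := x)) i)) \<noteq> 0"
    using x(2) unfolding det[symmetric] A_def .
  moreover have "\<forall>i<Suc n. (P(n := x)) i \<in> E"
    using P(1) x(1) by (auto simp: less_Suc_eq)
  ultimately show ?case by blast
qed

text \<open>A kernel vector would be the coefficient list of a nonzero polynomial of degree below
  \<open>n\<close> with \<open>n\<close> distinct roots.\<close>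

lemma vandermonde_fdet_nonzero:
  fixes t :: "nat \<Rightarrow> 'a::field_char_0"
  assumes "inj_on t {..<n}"
  shows "fdet n (\<lambda>i j. t j ^ i) \<noteq> 0"
proof
  assume "fdet n (\<lambda>i j. t j ^ i) = 0"
  hence "fdet n (\<lambda>i j. t i ^ j) = 0"
    by (subst fdet_transpose)
  then obtain v where v: "v \<in> carrier_vec n" "v \<noteq> 0\<^sub>v n"
      "Matrix.mat n n (\<lambda>(i, j). t i ^ j) *\<^sub>v v = 0\<^sub>v n"
    using det_0_iff_vec_prod_zero[of "Matrix.mat n n (\<lambda>(i, j). t i ^ j)" n] by auto
  define q where "q = (\<Sum>j<n. monom (v $ j) j)"
  have coeff: "coeff q j = v $ j" if "j < n" for j
    using that by (simp add: q_def coeff_sum if_distrib sum.delta cong: if_cong)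
  have "poly q (t i) = 0" if "i < n" for i
  proof -
    have "poly q (t i) = (Matrix.mat n n (\<lambda>(i, j). t i ^ j) *\<^sub>v v) $ i"
      using that v(1)
      by (auto simp: q_def poly_sum poly_monom scalar_prod_def mult.commute atLeast0LessThan intro!: sum.cong)
    thus ?thesis using v(3) that by simp
  qed
  hence sub: "t ` {..<n} \<subseteq> {x. poly q x = 0}" by auto
  have "q \<noteq> 0"
  proof
    assume "q = 0"
    hence "v = 0\<^sub>v n" using coeff v(1) by (intro eq_vecI) auto
    with v(2) show False by simp
  qed
  hence "card (t ` {..<n}) \<le> degree q"
    using card_mono[OF poly_roots_finite sub] card_poly_roots_bound[of q] by fastforce
  moreover have "card (t ` {..<n}) = n" using assms by (simp add: card_image)
  moreover have "degree q < n"
  proof -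
    have "n > 0"
      using v(1,2) by (cases n) auto
    thus ?thesis
      unfolding q_def by (intro degree_sum_less) (auto intro: le_less_trans[OF degree_monom_le])
  qed
  ultimately show False by simp
qed

section \<open>Upper bound for perturbed interpolation determinants\<close>

text \<open>Repeated division by \<open>z\<close> with removable singularities: only the factor
  \<open>z ^ N\<close> and an entire cofactor matter later, not the size of the remainder.\<close>

lemma entire_taylor_remainder:
  assumes "f holomorphic_on UNIV"
  shows "\<exists>c g. g holomorphic_on UNIV \<and> (\<forall>z. f z = (\<Sum>n<N. c n * z ^ n) + z ^ N * g z)"
proof (induction N)
  case 0
  show ?case using assms by (intro exI[of _ "\<lambda>_. 0"] exI[of _ f]) simp
next
  case (Suc N)
  then obtain c g where g: "g holomorphic_on UNIV" "\<And>z. f z = (\<Sum>n<N. c n * z ^ n) + z ^ N * g z"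
    by blast
  define h where "h z = (if z = 0 then deriv g 0 else (g z - g 0) / (z - 0))" for z
  have h: "h holomorphic_on UNIV"
    unfolding h_def by (rule pole_lemma_open[OF g(1) open_UNIV])
  have "g z = g 0 + z * h z" for z
    by (simp add: h_def)
  hence "z ^ N * g z = g 0 * z ^ N + z ^ Suc N * h z" for z
    by (metis distrib_left mult.assoc mult.commute power_Suc2)
  hence "f z = (\<Sum>n<Suc N. (c(N := g 0)) n * z ^ n) + z ^ Suc N * h z" for z
    unfolding g(2)[of z] by simp
  thus ?case using h by blast
qed

text \<open>Only the value \<open>N\<close> may repeat. The numbers below \<open>N\<close> missed by
  \<open>F\<close> are as many as the indices with value \<open>N\<close>, and each is smaller than
  \<open>N\<close>. Here \<open>F\<close> will list the powers of \<open>z\<close> chosen in the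
  rows of a determinant.\<close>

lemma sum_almost_distinct_ge:
  fixes F :: "nat \<Rightarrow> nat"
  assumes le: "\<And>i. i < N \<Longrightarrow> F i \<le> N"
    and inj: "\<And>i j. i < N \<Longrightarrow> j < N \<Longrightarrow> F i = F j \<Longrightarrow> F i < N \<Longrightarrow> i = j"
  shows "(\<Sum>n<N. n) \<le> (\<Sum>i<N. F i)"
proof -
  define J where "J = {i. i < N \<and> F i < N}"
  have fin: "finite J" and sub: "J \<subseteq> {..<N}" by (auto simp: J_def)
  have injJ: "inj_on F J" by (auto simp: inj_on_def J_def intro: inj)
  have img: "F ` J \<subseteq> {..<N}" by (auto simp: J_def)
  have "(\<Sum>n<N. n) = (\<Sum>n\<in>F ` J. n) + (\<Sum>n\<in>{..<N} - F ` J. n)"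
    using sum.subset_diff[OF img, of "\<lambda>n. n"] by simp
  also have "(\<Sum>n\<in>F ` J. n) = (\<Sum>i\<in>J. F i)"
    by (simp add: sum.reindex[OF injJ])
  also have "(\<Sum>n\<in>{..<N} - F ` J. n) \<le> (\<Sum>n\<in>{..<N} - F ` J. N)"
    by (intro sum_mono) auto
  also have "\<dots> = card ({..<N} - J) * N"
    using card_Diff_subset[OF finite_imageI[OF fin] img] card_Diff_subset[OF fin sub]
    by (simp add: card_image[OF injJ])
  also have "\<dots> = (\<Sum>i\<in>{..<N} - J. F i)"
  proof -
    have "F i = N" if "i \<in> {..<N} - J" for i
      using le[of i] that by (auto simp: J_def)
    thus ?thesis by simp
  qed
  also have "(\<Sum>i\<in>J. F i) + (\<Sum>i\<in>{..<N} - J. F i) = (\<Sum>i<N. F i)"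
    using sum.subset_diff[OF sub, of F] by simp
  finally show ?thesis by simp
qed

text \<open>
  Every perturbation of an entry carries the weight \<open>z\<^sup>N\<close>, which is enough to keep the
  full order of vanishing at the origin that the unperturbed determinant has.
\<close>

lemma interpolation_determinant_order:
  fixes f :: "nat \<Rightarrow> complex \<Rightarrow> complex" and \<zeta> :: "nat \<Rightarrow> complex" and \<delta> :: "nat \<Rightarrow> nat \<Rightarrow> complex"
  assumes hol: "\<And>j. j < N \<Longrightarrow> f j holomorphic_on UNIV"
  shows "\<exists>g. g holomorphic_on UNIV \<and>
    (\<forall>z. fdet N (\<lambda>j i. f j (z * \<zeta> i) * (1 + z ^ N * \<delta> i j)) = z ^ (\<Sum>n<N. n) * g z)"
proof -
  have "\<forall>j\<in>{..<N}. \<exists>c. \<exists>g. g holomorphic_on UNIV \<and> (\<forall>z. f j z = (\<Sum>n<N. c n * z ^ n) + z ^ N * g z)"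
    using entire_taylor_remainder[OF hol] by blast
  from bchoice[OF this] obtain c where
    "\<forall>j\<in>{..<N}. \<exists>g. g holomorphic_on UNIV \<and> (\<forall>z. f j z = (\<Sum>n<N. c j n * z ^ n) + z ^ N * g z)" ..
  from bchoice[OF this] obtain h where
    "\<forall>j\<in>{..<N}. h j holomorphic_on UNIV \<and> (\<forall>z. f j z = (\<Sum>n<N. c j n * z ^ n) + z ^ N * h j z)" ..
  hence h: "\<And>j. j < N \<Longrightarrow> h j holomorphic_on UNIV"
      "\<And>j z. j < N \<Longrightarrow> f j z = (\<Sum>n<N. c j n * z ^ n) + z ^ N * h j z"
    by auto
  \<comment> \<open>Index \<open>n < N\<close> stands for a Taylor term; index \<open>N\<close>
    collects all that is divisible by \<open>z ^ N\<close>, namely the Taylor remainder and the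
    perturbation.\<close>
  define T where "T z j n i = (if n < N then c j n * \<zeta> i ^ n
      else \<zeta> i ^ N * h j (z * \<zeta> i) + f j (z * \<zeta> i) * \<delta> i j)" for z j n i
  define \<Phi> where "\<Phi> = {F. (\<forall>i\<in>{0..<N}. F i \<in> {..N}) \<and> (\<forall>i. i \<notin> {0..<N} \<longrightarrow> F i = i)}"
  define D where "D F z = fdet N (\<lambda>j i. T z j (F j) i)" for F z
  have entry: "f j (z * \<zeta> i) * (1 + z ^ N * \<delta> i j) = (\<Sum>n\<le>N. z ^ n * T z j n i)" if "j < N" for z j i
  proof -
    have "(\<Sum>n\<le>N. z ^ n * T z j n i) = (\<Sum>n<N. z ^ n * T z j n i) + z ^ N * T z j N i"
      by (simp add: lessThan_Suc_atMost[symmetric])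
    also have "(\<Sum>n<N. z ^ n * T z j n i) = (\<Sum>n<N. c j n * (z * \<zeta> i) ^ n)"
      by (intro sum.cong) (auto simp: T_def power_mult_distrib)
    also have "\<dots> = f j (z * \<zeta> i) - (z * \<zeta> i) ^ N * h j (z * \<zeta> i)"
      using h(2)[OF that, of "z * \<zeta> i"] by simp
    finally show ?thesis
      by (simp add: T_def power_mult_distrib algebra_simps)
  qed
  have expand: "fdet N (\<lambda>j i. f j (z * \<zeta> i) * (1 + z ^ N * \<delta> i j))
      = (\<Sum>F\<in>\<Phi>. z ^ (\<Sum>j<N. F j) * D F z)" for z
  proof -
    have "fdet N (\<lambda>j i. f j (z * \<zeta> i) * (1 + z ^ N * \<delta> i j))
        = fdet N (\<lambda>j i. \<Sum>n\<in>{..N}. z ^ n * T z j n i)"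
      by (intro fdet_cong entry)
    also have "\<dots> = (\<Sum>F\<in>\<Phi>. fdet N (\<lambda>j i. z ^ F j * T z j (F j) i))"
      unfolding \<Phi>_def by (rule fdet_sum_rows) simp
    also have "\<dots> = (\<Sum>F\<in>\<Phi>. z ^ (\<Sum>j<N. F j) * D F z)"
      by (intro sum.cong refl) (simp only: fdet_scale_rows D_def power_sum atLeast0LessThan)
    finally show ?thesis .
  qed
  \<comment> \<open>Too small a total exponent forces two rows to use the same Taylor order below
    \<open>N\<close>; both are then multiples of the row of powers
    \<open>\<zeta> i ^ F j\<close>.\<close>
  have vanish: "D F z = 0" if F: "F \<in> \<Phi>" "(\<Sum>j<N. F j) < (\<Sum>n<N. n)" for F z
  proof -
    have "\<exists>i j. i < N \<and> j < N \<and> F i = F j \<and> F i < N \<and> i \<noteq> j"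
    proof (rule ccontr)
      assume "\<not> ?thesis"
      hence "(\<Sum>n<N. n) \<le> (\<Sum>i<N. F i)"
        using F(1) by (intro sum_almost_distinct_ge) (auto simp: \<Phi>_def)
      with F(2) show False by simp
    qed
    then obtain i j where ij: "i < N" "j < N" "F i = F j" "F i < N" "i \<noteq> j" by blast
    have "D F z = fdet N (\<lambda>j i. (if F j < N then c j (F j) else 1)
        * (if F j < N then \<zeta> i ^ F j else T z j N i))"
      using F(1) unfolding D_def by (intro fdet_cong) (auto simp: T_def \<Phi>_def)
    also have "\<dots> = 0"
      unfolding fdet_scale_rows using ij by (subst fdet_eq_rows[of i N j]) auto
    finally show ?thesis .
  qed
  have holT: "(\<lambda>z. T z j n i) holomorphic_on UNIV" if "j < N" for j n i
  proof -
    have comp: "(\<lambda>z. k (z * \<zeta> i)) holomorphic_on UNIV" if "k holomorphic_on UNIV"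
      for k :: "complex \<Rightarrow> complex"
    proof -
      have "(\<lambda>z. z * \<zeta> i) holomorphic_on UNIV" by (intro holomorphic_intros)
      from holomorphic_on_compose_gen[OF this that] show ?thesis by (simp add: o_def)
    qed
    show ?thesis
    proof (cases "n < N")
      case False
      thus ?thesis
        unfolding T_def using comp[OF h(1)[OF that]] comp[OF hol[OF that]]
        by (simp add: holomorphic_intros)
    qed (simp add: T_def)
  qed
  have holD: "D F holomorphic_on UNIV" for F
  proof -
    have "D F = (\<lambda>z. \<Sum>\<sigma> | \<sigma> permutes {0..<N}. of_int (sign \<sigma>) * (\<Prod>i=0..<N. T z i (F i) (\<sigma> i)))"
      unfolding D_def fdet_expand ..
    thus ?thesis by (auto intro!: holomorphic_intros holT)
  qed
  \<comment> \<open>The subtraction truncates only for those \<open>F\<close> whose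
    \<open>D F z\<close> vanishes, so the factorisation stays exact.\<close>
  define g where "g z = (\<Sum>F\<in>\<Phi>. z ^ ((\<Sum>j<N. F j) - (\<Sum>n<N. n)) * D F z)" for z
  have "g holomorphic_on UNIV"
    unfolding g_def by (intro holomorphic_intros holD)
  moreover have "(\<Sum>F\<in>\<Phi>. z ^ (\<Sum>j<N. F j) * D F z) = z ^ (\<Sum>n<N. n) * g z" for z
    unfolding g_def sum_distrib_left
  proof (intro sum.cong refl)
    fix F assume F: "F \<in> \<Phi>"
    show "z ^ (\<Sum>j<N. F j) * D F z
      = z ^ (\<Sum>n<N. n) * (z ^ ((\<Sum>j<N. F j) - (\<Sum>n<N. n)) * D F z)"
      using vanish[OF F, of z] by (cases "(\<Sum>j<N. F j) < (\<Sum>n<N. n)")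
        (auto simp: mult.assoc[symmetric] power_add[symmetric])
  qed
  ultimately show ?thesis using expand by auto
qed

text \<open>Schwarz lemma: the determinant scaled by \<open>z\<close> is a power of \<open>z\<close>
  times an entire \<open>g\<close>, and its value at \<open>z = 1\<close> is bounded by the maximum
  of \<open>g\<close> on the circle of radius \<open>\<rho>\<close>. There the Leibniz formula has
  \<open>fact N\<close> terms, and the perturbations cost at most \<open>(1 + 1 / N) ^ N\<close>,
  hence the factor \<open>exp 1\<close>.\<close>

lemma interpolation_determinant_bound:
  fixes f :: "nat \<Rightarrow> complex \<Rightarrow> complex" and \<zeta> :: "nat \<Rightarrow> complex" and \<delta> :: "nat \<Rightarrow> nat \<Rightarrow> complex"
  assumes hol: "\<And>j. j < N \<Longrightarrow> f j holomorphic_on UNIV"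
    and \<rho>: "\<rho> > 1" and N: "N > 0"
    and \<delta>: "\<And>i j. i < N \<Longrightarrow> j < N \<Longrightarrow> \<rho> ^ N * norm (\<delta> i j) \<le> 1 / real N"
    and bnd: "\<And>\<sigma> z. \<sigma> permutes {0..<N} \<Longrightarrow> norm z = \<rho> \<Longrightarrow> (\<Prod>i=0..<N. norm (f i (z * \<zeta> (\<sigma> i)))) \<le> B"
  shows "norm (fdet N (\<lambda>i j. f j (\<zeta> i) * (1 + \<delta> i j))) * \<rho> ^ (\<Sum>n<N. n) \<le> fact N * (exp 1 * B)"
proof -
  have "\<exists>g. g holomorphic_on UNIV \<and>
    (\<forall>z. fdet N (\<lambda>j i. f j (z * \<zeta> i) * (1 + z ^ N * \<delta> i j)) = z ^ (\<Sum>n<N. n) * g z)"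
    by (rule interpolation_determinant_order[OF hol])
  then obtain g where g: "g holomorphic_on UNIV"
    "\<And>z. fdet N (\<lambda>j i. f j (z * \<zeta> i) * (1 + z ^ N * \<delta> i j)) = z ^ (\<Sum>n<N. n) * g z"
    by blast
  have big: "norm (z ^ (\<Sum>n<N. n) * g z) \<le> fact N * (exp 1 * B)" if z: "norm z = \<rho>" for z
  proof -
    have "norm (z ^ (\<Sum>n<N. n) * g z)
        \<le> (\<Sum>\<sigma> | \<sigma> permutes {0..<N}. norm (of_int (sign \<sigma>)
            * (\<Prod>i=0..<N. f i (z * \<zeta> (\<sigma> i)) * (1 + z ^ N * \<delta> (\<sigma> i) i))))"
      unfolding g(2)[symmetric] fdet_expand by (rule norm_sum)
    also have "\<dots> \<le> (\<Sum>\<sigma> | \<sigma> permutes {0..<N}. exp 1 * B)"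
    proof (intro sum_mono)
      fix \<sigma> assume "\<sigma> \<in> {\<sigma>. \<sigma> permutes {0..<N}}"
      hence \<sigma>: "\<sigma> permutes {0..<N}" by simp
      have "norm (of_int (sign \<sigma>) * (\<Prod>i=0..<N. f i (z * \<zeta> (\<sigma> i)) * (1 + z ^ N * \<delta> (\<sigma> i) i)))
          = (\<Prod>i=0..<N. norm (f i (z * \<zeta> (\<sigma> i)))) * (\<Prod>i=0..<N. norm (1 + z ^ N * \<delta> (\<sigma> i) i))"
        by (simp add: norm_mult prod_norm[symmetric] prod.distrib sign_def)
      also have "\<dots> \<le> B * exp 1"
      proof (intro mult_mono bnd[OF \<sigma> z])
        have "(\<Prod>i=0..<N. norm (1 + z ^ N * \<delta> (\<sigma> i) i)) \<le> (\<Prod>i=0..<N. exp (1 / real N))"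
        proof (intro prod_mono conjI)
          fix i assume i: "i \<in> {0..<N}"
          hence "\<sigma> i < N" using permutes_in_image[OF \<sigma>] by fastforce
          hence "norm (z ^ N * \<delta> (\<sigma> i) i) \<le> 1 / real N"
            using \<delta>[of "\<sigma> i" i] i z by (simp add: norm_mult norm_power)
          hence "norm (1 + z ^ N * \<delta> (\<sigma> i) i) \<le> 1 + 1 / real N"
            using norm_triangle_ineq[of 1 "z ^ N * \<delta> (\<sigma> i) i"] by simp
          also have "\<dots> \<le> exp (1 / real N)" by (rule exp_ge_add_one_self)
          finally show "norm (1 + z ^ N * \<delta> (\<sigma> i) i) \<le> exp (1 / real N)" .
        qed simp
        also have "\<dots> = exp 1"
          using N by (simp add: exp_of_nat_mult[symmetric])
        finally show "(\<Prod>i=0..<N. norm (1 + z ^ N * \<delta> (\<sigma> i) i)) \<le> exp 1" .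
        show "0 \<le> B"
          using bnd[OF \<sigma> z] prod_nonneg[of "{0..<N}" "\<lambda>i. norm (f i (z * \<zeta> (\<sigma> i)))"] by simp
      qed (auto intro: prod_nonneg)
      finally show "norm (of_int (sign \<sigma>) * (\<Prod>i=0..<N. f i (z * \<zeta> (\<sigma> i)) * (1 + z ^ N * \<delta> (\<sigma> i) i)))
        \<le> exp 1 * B" by (simp add: mult.commute)
    qed
    also have "\<dots> = fact N * (exp 1 * B)"
      by (simp add: card_permutations[of "{0..<N}" N])
    finally show ?thesis .
  qed
  have "norm (g 1) \<le> fact N * (exp 1 * B) / \<rho> ^ (\<Sum>n<N. n)"
  proof (rule maximum_modulus_frontier[of g "cball 0 \<rho>"])
    fix z :: complex assume "z \<in> frontier (cball 0 \<rho>)"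
    hence z: "norm z = \<rho>" by (simp add: frontier_cball)
    have "\<rho> ^ (\<Sum>n<N. n) * norm (g z) \<le> fact N * (exp 1 * B)"
      using big[OF z] by (simp add: norm_mult norm_power z)
    thus "norm (g z) \<le> fact N * (exp 1 * B) / \<rho> ^ (\<Sum>n<N. n)"
      using \<rho> by (simp add: field_simps)
  qed (use \<rho> g(1) in \<open>auto intro: holomorphic_on_subset holomorphic_on_imp_continuous_on\<close>)
  moreover have "fdet N (\<lambda>i j. f j (\<zeta> i) * (1 + \<delta> i j)) = g 1"
    using g(2)[of 1] fdet_transpose[of N "\<lambda>j i. f j (\<zeta> i) * (1 + \<delta> i j)"] by simp
  ultimately show ?thesis
    using \<rho> by (simp add: field_simps)
qed

section \<open>Zero estimate\<close>

text \<open>Compared with monomials, these polynomials still take integer values at integers, while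
  the division by \<open>fact k\<close> sharpens the analytic upper bound.\<close>

definition gbinomial_poly :: "nat \<Rightarrow> real poly" where
  "gbinomial_poly k = Polynomial.smult (1 / fact k) (\<Prod>i<k. [:- real i, 1:])"

lemma poly_gbinomial_poly: "poly (gbinomial_poly k) x = x gchoose k"
  by (simp add: gbinomial_poly_def poly_prod gbinomial_prod_rev atLeast0LessThan)

lemma degree_gbinomial_poly_le: "degree (gbinomial_poly k) \<le> k"
proof -
  have "degree (\<Prod>i<k. [:- real i, 1:]) \<le> (\<Sum>i<k. degree [:- real i, 1:])"
    using degree_prod_sum_le[of "{..<k}" "\<lambda>i. [:- real i, 1:]"] by (simp add: o_def)
  thus ?thesis by (simp add: gbinomial_poly_def)
qed

text \<open>Evaluation at \<open>0, 1, 2, ...\<close> gives a triangular system: at \<open>k\<close>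
  the terms of index above \<open>k\<close> vanish and those below are zero by induction.\<close>

lemma gbinomial_poly_independent:
  assumes "(\<Sum>k<K. Polynomial.smult (c k) (gbinomial_poly k)) = 0" "k < K"
  shows "c k = 0"
  using assms(2)
proof (induction k rule: less_induct)
  case (less k)
  have "0 = poly (\<Sum>i<K. Polynomial.smult (c i) (gbinomial_poly i)) (real k)"
    by (simp add: assms(1))
  also have "\<dots> = (\<Sum>i<K. c i * real (k choose i))"
    by (simp add: poly_sum poly_gbinomial_poly binomial_gbinomial)
  also have "\<dots> = (\<Sum>i\<in>{k}. c i * real (k choose i))"
  proof (rule sum.mono_neutral_right)
    show "\<forall>i\<in>{..<K} - {k}. c i * real (k choose i) = 0"
    proof
      fix i assume i: "i \<in> {..<K} - {k}"
      show "c i * real (k choose i) = 0"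
        using i less.IH[of i] by (cases "i < k") auto
    qed
  qed (use less.prems in auto)
  finally show ?case by simp
qed

section \<open>Leading coefficients of polynomial determinants and the zero estimate\<close>

text \<open>The degree bound is part of the induction because it removes all other terms of the
  convolution.\<close>

lemma coeff_prod_sum_degrees:
  fixes q :: "'b \<Rightarrow> 'a::comm_semiring_1 poly"
  assumes "finite A" "\<And>i. i \<in> A \<Longrightarrow> degree (q i) \<le> d i"
  shows "coeff (\<Prod>i\<in>A. q i) (\<Sum>i\<in>A. d i) = (\<Prod>i\<in>A. coeff (q i) (d i)) \<and>
    degree (\<Prod>i\<in>A. q i) \<le> (\<Sum>i\<in>A. d i)"
  using assms
proof (induction A rule: finite_induct)
  case (insert x A)
  hence IH: "coeff (\<Prod>i\<in>A. q i) (\<Sum>i\<in>A. d i) = (\<Prod>i\<in>A. coeff (q i) (d i))"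
      "degree (\<Prod>i\<in>A. q i) \<le> (\<Sum>i\<in>A. d i)" and x: "degree (q x) \<le> d x"
    by auto
  have "coeff (q x * (\<Prod>i\<in>A. q i)) (d x + (\<Sum>i\<in>A. d i))
      = (\<Sum>j\<le>d x + (\<Sum>i\<in>A. d i). coeff (q x) j * coeff (\<Prod>i\<in>A. q i) (d x + (\<Sum>i\<in>A. d i) - j))"
    by (rule coeff_mult)
  also have "\<dots> = (\<Sum>j\<in>{d x}. coeff (q x) j * coeff (\<Prod>i\<in>A. q i) (d x + (\<Sum>i\<in>A. d i) - j))"
  proof (rule sum.mono_neutral_right)
    show "\<forall>j\<in>{..d x + (\<Sum>i\<in>A. d i)} - {d x}.
        coeff (q x) j * coeff (\<Prod>i\<in>A. q i) (d x + (\<Sum>i\<in>A. d i) - j) = 0"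
    proof
      fix j assume j: "j \<in> {..d x + (\<Sum>i\<in>A. d i)} - {d x}"
      show "coeff (q x) j * coeff (\<Prod>i\<in>A. q i) (d x + (\<Sum>i\<in>A. d i) - j) = 0"
      proof (cases "j < d x")
        case True
        hence "degree (\<Prod>i\<in>A. q i) < d x + (\<Sum>i\<in>A. d i) - j" using IH(2) by simp
        thus ?thesis by (simp add: coeff_eq_0)
      next
        case False
        hence "degree (q x) < j" using j x by simp
        thus ?thesis by (simp add: coeff_eq_0)
      qed
    qed
  qed auto
  finally have "coeff (q x * (\<Prod>i\<in>A. q i)) (d x + (\<Sum>i\<in>A. d i))
      = coeff (q x) (d x) * (\<Prod>i\<in>A. coeff (q i) (d i))"
    using IH(1) by simp
  moreover have "degree (q x * (\<Prod>i\<in>A. q i)) \<le> d x + (\<Sum>i\<in>A. d i)"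
    using degree_mult_le[of "q x" "\<Prod>i\<in>A. q i"] IH(2) x by linarith
  ultimately show ?case using insert.hyps by simp
qed simp

text \<open>The bounds \<open>d j\<close> depend on the column only, and every Leibniz term meets
  each column once, so all terms share the same top degree.\<close>

lemma coeff_fdet_sum_degrees:
  fixes Q :: "nat \<Rightarrow> nat \<Rightarrow> 'a::comm_ring_1 poly"
  assumes "\<And>i j. i < m \<Longrightarrow> j < m \<Longrightarrow> degree (Q i j) \<le> d j"
  shows "coeff (fdet m Q) (\<Sum>j<m. d j) = fdet m (\<lambda>i j. coeff (Q i j) (d j))"
proof -
  have "coeff (of_int (sign \<sigma>) * (\<Prod>i=0..<m. Q i (\<sigma> i))) (\<Sum>j<m. d j)
      = of_int (sign \<sigma>) * (\<Prod>i=0..<m. coeff (Q i (\<sigma> i)) (d (\<sigma> i)))"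
    if \<sigma>: "\<sigma> permutes {0..<m}" for \<sigma>
  proof -
    have "(\<Sum>j<m. d j) = (\<Sum>i=0..<m. d (\<sigma> i))"
      using sum.permute[OF \<sigma>, of d] by (simp add: atLeast0LessThan o_def)
    moreover have "degree (Q i (\<sigma> i)) \<le> d (\<sigma> i)" if "i \<in> {0..<m}" for i
      using that permutes_in_image[OF \<sigma>, of i] by (intro assms) auto
    ultimately have "coeff (\<Prod>i=0..<m. Q i (\<sigma> i)) (\<Sum>j<m. d j)
        = (\<Prod>i=0..<m. coeff (Q i (\<sigma> i)) (d (\<sigma> i)))"
      using coeff_prod_sum_degrees[of "{0..<m}" "\<lambda>i. Q i (\<sigma> i)" "\<lambda>i. d (\<sigma> i)"] by simp
    thus ?thesis by (simp add: sign_def)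
  qed
  thus ?thesis
    unfolding fdet_expand coeff_sum by (intro sum.cong) auto
qed

lemma poly_fdet: "poly (fdet m Q) x = fdet m (\<lambda>i j. poly (Q i j) x)"
  unfolding fdet_expand by (simp add: poly_sum poly_prod)

lemma fdet_kernel:
  fixes F :: "nat \<Rightarrow> nat \<Rightarrow> 'a::idom"
  assumes "\<And>i. i < m \<Longrightarrow> (\<Sum>j<m. F i j * v j) = 0" "k < m" "v k \<noteq> 0"
  shows "fdet m F = 0"
proof (subst det_0_iff_vec_prod_zero[of _ m], simp, intro exI[of _ "vec m v"] conjI)
  show "vec m v \<noteq> 0\<^sub>v m"
  proof
    assume "vec m v = 0\<^sub>v m"
    hence "vec m v $ k = 0\<^sub>v m $ k" by simp
    with assms(2,3) show False by simp
  qed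
  show "Matrix.mat m m (\<lambda>(i, j). F i j) *\<^sub>v vec m v = 0\<^sub>v m"
    using assms(1) by (intro eq_vecI) (auto simp: scalar_prod_def atLeast0LessThan)
qed simp

text \<open>
  If all values vanished, the shifts of the function along the first generator would give a square
  system with a nontrivial kernel at every remaining point; its determinant is a polynomial whose
  leading coefficient is a Vandermonde determinant.
\<close>

lemma zero_estimate:
  fixes p b :: int and \<theta>1 \<theta>2 :: real and a C H K :: nat and P :: "nat \<Rightarrow> real poly"
  assumes "\<theta>1 > 0" "coprime b p" "2 * int C < p" "K > 0"
    and count: "K * (2 * H + 1) \<le> (2 * a + 1) * (2 * C + 1)"
    and deg: "\<And>l. degree (P l) < K"
    and nz: "l0 < 2 * H + 1" "P l0 \<noteq> 0"
  shows "\<exists>r s. \<bar>r\<bar> \<le> int (a + H) \<and> \<bar>s\<bar> \<le> int C \<and>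
    (\<Sum>l<2 * H + 1. poly (P l) (of_int (r * p + s * b))
       * exp ((real l - real H) * (of_int r * \<theta>1 + of_int s * \<theta>2))) \<noteq> 0"
proof (rule ccontr)
  assume neg: "\<not> ?thesis"
  define L where "L = 2 * H + 1"
  have zero: "(\<Sum>l<L. poly (P l) (of_int (r * p + s * b))
       * exp ((real l - real H) * (of_int r * \<theta>1 + of_int s * \<theta>2))) = 0"
    if "\<bar>r\<bar> \<le> int (a + H)" "\<bar>s\<bar> \<le> int C" for r s
    using neg that unfolding L_def by blast
  \<comment> \<open>Only nonzero polynomials give columns, since their leading coefficients must not
    vanish.\<close>
  define \<Omega> where "\<Omega> = {l. l < L \<and> P l \<noteq> 0}"
  define m where "m = card \<Omega>"
  have fin: "finite \<Omega>" and l0: "l0 \<in> \<Omega>" using nz by (auto simp: \<Omega>_def L_def)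
  have mL: "m \<le> L"
    unfolding m_def using card_mono[of "{..<L}" \<Omega>] by (auto simp: \<Omega>_def)
  have mpos: "m > 0" using fin l0 by (auto simp: m_def card_gt_0_iff)
  obtain e where e: "bij_betw e {0..<m} \<Omega>"
    using ex_bij_betw_nat_finite[OF fin] by (auto simp: m_def)
  have eP: "P (e j) \<noteq> 0" if "j < m" for j
    using bij_betwE[OF e] that by (auto simp: \<Omega>_def)
  define u where "u j = real (e j) - real H" for j
  define sh where "sh i = int i - int H" for i
  \<comment> \<open>Row \<open>i\<close> shifts the first coordinate by \<open>sh i\<close>, between
    \<open>- H\<close> and \<open>H\<close>. The shift contributes the scalar exponential; the
    factor \<open>exp (u j * w)\<close>, common to all rows, becomes the kernel vector.\<close>
  define Q where "Q i j = Polynomial.smult (exp (u j * (of_int (sh i) * \<theta>1)))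
      (pcompose (P (e j)) [:of_int (sh i * p), 1:])" for i j
  define d where "d j = degree (P (e j))" for j
  have degQ: "degree (Q i j) = d j" for i j
    by (simp add: Q_def d_def degree_pcompose)
  have coeffQ: "coeff (Q i j) (d j) = exp (u j * (of_int (sh i) * \<theta>1)) * lead_coeff (P (e j))" for i j
  proof -
    have "coeff (pcompose (P (e j)) [:of_int (sh i * p), 1:]) (d j) = lead_coeff (P (e j))"
      using lead_coeff_comp[of "[:of_int (sh i * p), 1:]" "P (e j)"] by (simp add: d_def degree_pcompose)
    thus ?thesis by (simp add: Q_def)
  qed
  have "coeff (fdet m Q) (\<Sum>j<m. d j) = fdet m (\<lambda>i j. coeff (Q i j) (d j))"
    by (intro coeff_fdet_sum_degrees) (simp add: degQ)
  also have "\<dots> = fdet m (\<lambda>j i. exp (u j * (of_int (sh i) * \<theta>1)) * lead_coeff (P (e j)))"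
    by (subst fdet_transpose) (simp only: coeffQ)
  also have "\<dots> = fdet m (\<lambda>j i. (lead_coeff (P (e j)) * exp (- (u j * (real H * \<theta>1)))) * exp (u j * \<theta>1) ^ i)"
    by (intro fdet_cong)
       (simp add: sh_def algebra_simps exp_of_nat_mult[symmetric] exp_add[symmetric] exp_diff exp_minus field_simps)
  also have "\<dots> = (\<Prod>j=0..<m. lead_coeff (P (e j)) * exp (- (u j * (real H * \<theta>1))))
      * fdet m (\<lambda>i j. exp (u j * \<theta>1) ^ i)"
    unfolding fdet_scale_rows by (subst fdet_transpose) (rule refl)
  also have "\<dots> \<noteq> 0"
  proof -
    have "inj_on (\<lambda>j. exp (u j * \<theta>1)) {..<m}"
      using bij_betw_imp_inj_on[OF e] \<open>\<theta>1 > 0\<close> by (auto simp: inj_on_def u_def)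
    from vandermonde_fdet_nonzero[OF this] show ?thesis
      using eP by (simp add: prod_zero_iff)
  qed
  finally have Dnz: "fdet m Q \<noteq> 0" by auto
  have degD: "degree (fdet m Q) \<le> (K - 1) * m"
  proof (rule degree_det_le)
    fix i j assume "i < m" "j < m"
    thus "degree (Matrix.mat m m (\<lambda>(i, j). Q i j) $$ (i, j)) \<le> K - 1"
      using deg[of "e j"] by (simp add: degQ d_def)
  qed simp
  \<comment> \<open>The base points leave a margin of \<open>H\<close> in the first coordinate, so
    that all shifts stay in the range where the function is assumed to vanish.\<close>
  define E where "E = {- int a..int a} \<times> {- int C..int C}"
  define X where "X = (\<lambda>(r, s). r * p + s * b)"
  have root: "poly (fdet m Q) (of_int (X q)) = 0" if "q \<in> E" for q
  proof -
    obtain r s where q: "q = (r, s)" by (cases q)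
    with that have rs: "\<bar>r\<bar> \<le> int a" "\<bar>s\<bar> \<le> int C" by (auto simp: E_def)
    define w where "w = of_int r * \<theta>1 + of_int s * \<theta>2"
    show ?thesis
      unfolding poly_fdet
    proof (rule fdet_kernel[where v = "\<lambda>j. exp (u j * w)"])
      fix i assume i: "i < m"
      have "\<bar>r + sh i\<bar> \<le> int (a + H)"
        using rs(1) i mL by (auto simp: sh_def L_def)
      from zero[OF this rs(2)]
      have "0 = (\<Sum>l<L. poly (P l) (of_int ((r + sh i) * p + s * b))
          * exp ((real l - real H) * (of_int (r + sh i) * \<theta>1 + of_int s * \<theta>2)))" by simp
      also have "\<dots> = (\<Sum>l\<in>\<Omega>. poly (P l) (of_int ((r + sh i) * p + s * b))
          * exp ((real l - real H) * (of_int (r + sh i) * \<theta>1 + of_int s * \<theta>2)))"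
        by (rule sum.mono_neutral_right) (auto simp: \<Omega>_def)
      also have "\<dots> = (\<Sum>j=0..<m. poly (P (e j)) (of_int ((r + sh i) * p + s * b))
          * exp (u j * (of_int (r + sh i) * \<theta>1 + of_int s * \<theta>2)))"
        unfolding u_def by (rule sum.reindex_bij_betw[OF e, symmetric])
      also have "\<dots> = (\<Sum>j<m. poly (Q i j) (of_int (X q)) * exp (u j * w))"
        unfolding atLeast0LessThan
        by (intro sum.cong refl)
           (simp add: Q_def X_def q w_def poly_pcompose exp_add[symmetric] algebra_simps)
      finally show "(\<Sum>j<m. poly (Q i j) (of_int (X q)) * exp (u j * w)) = 0" by simp
    qed (use mpos in auto)
  qed
  have injX: "inj_on X E"
  proof (rule inj_onI, clarify)
    fix r s r' s' assume h: "(r, s) \<in> E" "(r', s') \<in> E" "X (r, s) = X (r', s')"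
    hence "(r' - r) * p = (s - s') * b" by (simp add: X_def algebra_simps)
    hence "p dvd (s - s') * b" by (metis dvd_triv_right)
    hence "p dvd s - s'"
      using assms(2) by (simp add: coprime_commute coprime_dvd_mult_left_iff)
    moreover have "\<bar>s - s'\<bar> < p"
      using h assms(3) by (auto simp: E_def)
    ultimately have "s = s'"
      using zdvd_imp_le[of p "\<bar>s - s'\<bar>"] by auto
    with h(3) assms(3) show "r = r' \<and> s = s'" by (simp add: X_def)
  qed
  have sub: "(\<lambda>q. of_int (X q)) ` E \<subseteq> {x. poly (fdet m Q) x = 0}"
    using root by auto
  have injX': "inj_on (\<lambda>q. real_of_int (X q)) E"
    using injX by (auto simp: inj_on_def)
  have "card ((\<lambda>q. real_of_int (X q)) ` E) = (2 * a + 1) * (2 * C + 1)"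
  proof -
    have "card {- int n..int n} = 2 * n + 1" for n by simp
    with injX' show ?thesis
      by (simp only: card_image E_def card_cartesian_product)
  qed
  \<comment> \<open>Distinct roots are counted against the degree: \<open>X\<close> is injective on
    \<open>E\<close> because \<open>b\<close> is coprime to \<open>p\<close> and
    \<open>2 * C < p\<close>.\<close>
  hence "(2 * a + 1) * (2 * C + 1) \<le> (K - 1) * m"
    using card_mono[OF poly_roots_finite[OF Dnz] sub] card_poly_roots_bound[OF Dnz] degD by linarith
  also have "\<dots> \<le> (K - 1) * L" using mL by simp
  also have "\<dots> < K * L" using assms(4) by (intro mult_strict_right_mono) (auto simp: L_def)
  finally show False using count by (simp add: L_def)
qed

section \<open>Reduction to a linear form in two logarithms\<close>

text \<open>
  Conjugate elements of \<open>\<int>[\<surd>2]\<close>, as a relation between real numbers: this keeps the real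
  exponentials and logarithms available without an embedding.
\<close>

definition conj_pair :: "real \<Rightarrow> real \<Rightarrow> bool" where
  "conj_pair A A' \<longleftrightarrow> (\<exists>u v::int. A = of_int u + of_int v * sqrt 2 \<and> A' = of_int u - of_int v * sqrt 2)"

lemma conj_pair_sym: "conj_pair A A' \<Longrightarrow> conj_pair A' A"
  unfolding conj_pair_def
proof (elim exE conjE)
  fix u v :: int
  assume "A = of_int u + of_int v * sqrt 2" "A' = of_int u - of_int v * sqrt 2"
  thus "\<exists>u v::int. A' = of_int u + of_int v * sqrt 2 \<and> A = of_int u - of_int v * sqrt 2"
    by (intro exI[of _ u] exI[of _ "- v"]) simp
qed

lemma conj_pair_of_int: "conj_pair (of_int u) (of_int u)"
  unfolding conj_pair_def by (rule exI[of _ u], rule exI[of _ 0]) simp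

lemma conj_pair_1: "conj_pair 1 1"
  using conj_pair_of_int[of 1] by simp

lemma conj_pair_add:
  assumes "conj_pair A A'" "conj_pair B B'"
  shows "conj_pair (A + B) (A' + B')"
proof -
  obtain u v s t :: int where eqs: "A = of_int u + of_int v * sqrt 2" "A' = of_int u - of_int v * sqrt 2"
    "B = of_int s + of_int t * sqrt 2" "B' = of_int s - of_int t * sqrt 2"
    using assms unfolding conj_pair_def by blast
  show ?thesis
    unfolding conj_pair_def eqs
    by (rule exI[of _ "u + s"], rule exI[of _ "v + t"]) (simp add: algebra_simps)
qed

lemma conj_pair_mult:
  assumes "conj_pair A A'" "conj_pair B B'"
  shows "conj_pair (A * B) (A' * B')"
proof -
  obtain u v s t :: int where eqs: "A = of_int u + of_int v * sqrt 2" "A' = of_int u - of_int v * sqrt 2"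
    "B = of_int s + of_int t * sqrt 2" "B' = of_int s - of_int t * sqrt 2"
    using assms unfolding conj_pair_def by blast
  show ?thesis
    unfolding conj_pair_def eqs
    by (rule exI[of _ "u * s + 2 * v * t"], rule exI[of _ "u * t + v * s"]) (simp add: algebra_simps)
qed

lemma conj_pair_minus: "conj_pair A A' \<Longrightarrow> conj_pair (- A) (- A')"
  using conj_pair_mult[OF conj_pair_of_int[of "-1"], of A A'] by simp

lemma conj_pair_power: "conj_pair A A' \<Longrightarrow> conj_pair (A ^ n) (A' ^ n)"
  by (induction n) (auto intro: conj_pair_1 conj_pair_mult)

lemma conj_pair_sum:
  "(\<And>i. i \<in> I \<Longrightarrow> conj_pair (A i) (A' i)) \<Longrightarrow> conj_pair (\<Sum>i\<in>I. A i) (\<Sum>i\<in>I. A' i)"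
  by (induction I rule: infinite_finite_induct)
     (auto intro: conj_pair_add conj_pair_of_int[of 0, simplified])

section \<open>Elements of small norm and the factorisation of \<open>x + sqrt 2\<close>\<close>

lemma square_eq_twice_square_int:
  fixes i j :: int
  assumes "i\<^sup>2 = 2 * j\<^sup>2"
  shows "j = 0"
proof (rule ccontr)
  assume j: "j \<noteq> 0"
  with assms have i: "i \<noteq> 0" by auto
  have "multiplicity 2 (i\<^sup>2) = 2 * multiplicity 2 i"
    using i by (intro prime_elem_multiplicity_power_distrib) auto
  moreover have "multiplicity 2 (2 * j\<^sup>2) = 1 + 2 * multiplicity 2 j"
    using j prime_elem_multiplicity_mult_distrib[of "2::int" 2 "j\<^sup>2"]
      prime_elem_multiplicity_power_distrib[of "2::int" j 2] by simp
  ultimately have "2 * multiplicity 2 i = 1 + 2 * multiplicity 2 j" using assms by simp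
  thus False by presburger
qed

text \<open>The binomial theorem modulo \<open>b\<close>, with conjugate cofactors on the two sides.
  With \<open>b\<close> a multiple of the conjugate of \<open>x + sqrt 2\<close>, it lets
  \<open>y ^ p\<close> be divided out below.\<close>

lemma binomial_split_conj_pair:
  assumes "conj_pair a a'" "conj_pair b b'"
  shows "\<exists>g g'. conj_pair g g' \<and> (a + b) ^ n = a ^ n + b * g \<and> (a' + b') ^ n = a' ^ n + b' * g'"
proof (induction n)
  case 0
  show ?case using conj_pair_of_int[of 0] by auto
next
  case (Suc n)
  then obtain g g' where g: "conj_pair g g'" "(a + b) ^ n = a ^ n + b * g" "(a' + b') ^ n = a' ^ n + b' * g'"
    by blast
  show ?case
    by (rule exI[of _ "a ^ n + (a + b) * g"], rule exI[of _ "a' ^ n + (a' + b') * g'"])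
       (use g assms in \<open>auto simp: algebra_simps intro!: conj_pair_add conj_pair_mult conj_pair_power\<close>)
qed

text \<open>Thue's pigeonhole argument: more than \<open>y\<close> pairs \<open>(a, c)\<close> give
  two with \<open>a - x * c\<close> congruent modulo \<open>y\<close>. Their difference has norm
  divisible by \<open>y\<close> and between \<open>- 2 * y\<close> and \<open>y\<close>; it remains
  to exclude \<open>0\<close> and \<open>- 2 * y\<close>.\<close>

lemma exists_norm_representation:
  fixes x y :: int
  assumes "y > 1" "coprime x y" "y dvd x\<^sup>2 - 2"
  shows "\<exists>i j m. i = x * j + y * m \<and> \<bar>i\<^sup>2 - 2 * j\<^sup>2\<bar> = y"
proof -
  define n where "n = \<lfloor>sqrt (of_int y)\<rfloor>"
  have n0: "n \<ge> 0" using assms(1) by (simp add: n_def)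
  have "of_int n \<le> sqrt (of_int y)" unfolding n_def by linarith
  hence "(of_int n)\<^sup>2 \<le> (sqrt (of_int y))\<^sup>2" using n0 by (intro power_mono) auto
  hence "of_int (n\<^sup>2) \<le> (of_int y :: real)" using assms(1) by simp
  hence n1: "n\<^sup>2 \<le> y" by linarith
  have "sqrt (of_int y) < of_int (n + 1)" unfolding n_def by linarith
  hence "(sqrt (of_int y))\<^sup>2 < (of_int (n + 1))\<^sup>2" using assms(1) by (intro power_strict_mono) auto
  hence "of_int y < (of_int ((n + 1)\<^sup>2) :: real)" using assms(1) by simp
  hence n2: "y < (n + 1)\<^sup>2" by linarith
  define f where "f = (\<lambda>(a, c). (a - x * c) mod y)"
  have "f ` ({0..n} \<times> {0..n}) \<subseteq> {0..<y}" using assms(1) by (auto simp: f_def)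
  hence "card (f ` ({0..n} \<times> {0..n})) \<le> nat y"
    using card_mono[of "{0..<y}"] by fastforce
  also have "\<dots> < nat ((n + 1)\<^sup>2)" using n2 assms(1) n0 by simp
  also have "\<dots> = card ({0..n} \<times> {0..n})"
    using n0 by (simp add: card_cartesian_product power2_eq_square nat_mult_distrib)
  finally have "\<not> inj_on f ({0..n} \<times> {0..n})" by (metis card_image less_irrefl)
  then obtain a c a' c' where ac: "a \<in> {0..n}" "c \<in> {0..n}" "a' \<in> {0..n}" "c' \<in> {0..n}"
      "f (a, c) = f (a', c')" "(a, c) \<noteq> (a', c')"
    unfolding inj_on_def by blast
  define i j where "i = a - a'" and "j = c - c'"
  have "y dvd (a - x * c) - (a' - x * c')"
    using ac(5) by (simp add: f_def mod_eq_dvd_iff)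
  hence "y dvd i - x * j" by (simp add: i_def j_def algebra_simps)
  then obtain m where m: "i = x * j + y * m" by (auto simp: dvd_def algebra_simps)
  have "\<bar>i\<bar> \<le> n" "\<bar>j\<bar> \<le> n" using ac by (auto simp: i_def j_def)
  hence ij: "i\<^sup>2 \<le> y" "j\<^sup>2 \<le> y"
    using n1 power_mono[of "\<bar>i\<bar>" n 2] power_mono[of "\<bar>j\<bar>" n 2] by auto
  obtain w where w: "x\<^sup>2 - 2 = y * w" using assms(3) by auto
  have "i\<^sup>2 - 2 * j\<^sup>2 = (x\<^sup>2 - 2) * j\<^sup>2 + y * (2 * x * j * m + y * m\<^sup>2)"
    unfolding m by (simp add: power2_eq_square algebra_simps)
  also have "\<dots> = y * (w * j\<^sup>2 + 2 * x * j * m + y * m\<^sup>2)"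
    unfolding w by (simp add: algebra_simps)
  finally obtain q where q: "i\<^sup>2 - 2 * j\<^sup>2 = y * q" by blast
  have "y * q \<le> y * 1" "y * (-2) \<le> y * q"
    using ij q zero_le_power2[of j] zero_le_power2[of i] by linarith+
  hence qr: "q \<le> 1" "-2 \<le> q" using assms(1) by (simp_all only: mult_le_cancel_left_pos)
  have "q \<noteq> 0"
  proof
    assume "q = 0"
    hence "i\<^sup>2 = 2 * j\<^sup>2" using q by simp
    hence "j = 0" by (rule square_eq_twice_square_int)
    hence "i = 0" using \<open>i\<^sup>2 = 2 * j\<^sup>2\<close> by simp
    with \<open>j = 0\<close> ac(6) show False by (simp add: i_def j_def)
  qed
  \<comment> \<open>In this boundary case \<open>i = 0\<close> and \<open>j\<^sup>2 = y\<close>;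
    coprimality gives \<open>y dvd j\<close>, hence \<open>y dvd 1\<close>.\<close>
  moreover have "q \<noteq> -2"
  proof
    assume "q = -2"
    hence "i\<^sup>2 + 2 * y = 2 * j\<^sup>2" using q by simp
    hence "i\<^sup>2 \<le> 0" using ij by linarith
    hence i0: "i\<^sup>2 = 0" by simp
    hence jy: "j\<^sup>2 = y" using q \<open>q = -2\<close> by simp
    have "x * j = y * (- m)" using m i0 by simp
    hence "y dvd x * j" by simp
    hence "y dvd j" using assms(2) by (simp add: coprime_commute coprime_dvd_mult_right_iff)
    then obtain k where "j = y * k" by auto
    hence "y * (y * k\<^sup>2) = y * 1" using jy by (simp add: power2_eq_square algebra_simps)
    hence "y * k\<^sup>2 = 1" using assms(1) by simp
    hence "y dvd 1" by (metis dvd_triv_left)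
    thus False using assms(1) by simp
  qed
  ultimately have "q = 1 \<or> q = -1" using qr by linarith
  hence "\<bar>i\<^sup>2 - 2 * j\<^sup>2\<bar> = y" using q assms(1) by auto
  with m show ?thesis by blast
qed


text \<open>
  Unique factorisation is not needed: with \<open>\<beta> = y m + j (x + \<surd>2)\<close> of norm \<open>\<plusminus>y\<close>, the product of
  \<open>x + \<surd>2\<close> and the conjugate of \<open>\<beta>\<^sup>p\<close> is divisible by \<open>y\<^sup>p = (x + \<surd>2) (x - \<surd>2)\<close>.
\<close>

lemma lebesgue_nagell_factorisation:
  fixes x y :: int and p :: nat
  assumes "y > 1" "coprime x y" "x\<^sup>2 - 2 = y ^ p" "p > 0"
  obtains \<beta> \<beta>' W W' :: real
  where "conj_pair \<beta> \<beta>'" "\<bar>\<beta> * \<beta>'\<bar> = of_int y" "conj_pair W W'" "\<bar>W * W'\<bar> = 1"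
    "\<bar>of_int x + sqrt 2\<bar> = \<bar>W\<bar> * \<bar>\<beta>\<bar> ^ p"
proof -
  have "y dvd x\<^sup>2 - 2" using assms by simp
  then obtain i j m where ijm: "i = x * j + y * m" "\<bar>i\<^sup>2 - 2 * j\<^sup>2\<bar> = y"
    using exists_norm_representation[OF assms(1,2)] by blast
  define A A' where "A = of_int x + sqrt 2" and "A' = of_int x - sqrt 2"
  define \<beta> \<beta>' where "\<beta> = of_int i + of_int j * sqrt 2" and "\<beta>' = of_int i - of_int j * sqrt 2"
  have A: "conj_pair A A'"
    unfolding conj_pair_def A_def A'_def by (rule exI[of _ x], rule exI[of _ 1]) simp
  have \<beta>: "conj_pair \<beta> \<beta>'"
    unfolding conj_pair_def \<beta>_def \<beta>'_def by blast
  have AA: "A * A' = of_int y ^ p"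
  proof -
    have "A * A' = of_int (x\<^sup>2 - 2)"
      by (simp add: A_def A'_def algebra_simps power2_eq_square)
    thus ?thesis using assms(3) by simp
  qed
  have "\<beta> * \<beta>' = of_int (i\<^sup>2 - 2 * j\<^sup>2)"
    by (simp add: \<beta>_def \<beta>'_def algebra_simps power2_eq_square)
  hence \<beta>\<beta>: "\<bar>\<beta> * \<beta>'\<bar> = of_int y" using ijm(2) by (metis of_int_abs)
  have y0: "(of_int y :: real) > 0" using assms(1) by simp
  have "conj_pair (of_int (y * m)) (of_int (y * m))" by (rule conj_pair_of_int)
  moreover have "conj_pair (of_int j * A') (of_int j * A)"
    by (intro conj_pair_mult conj_pair_of_int conj_pair_sym[OF A])
  ultimately obtain g g' where g: "conj_pair g g'"
    "(of_int (y * m) + of_int j * A') ^ p = of_int (y * m) ^ p + of_int j * A' * g"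
    "(of_int (y * m) + of_int j * A) ^ p = of_int (y * m) ^ p + of_int j * A * g'"
    using binomial_split_conj_pair by blast
  \<comment> \<open>\<open>W\<close> is \<open>A * \<beta>' ^ p / y ^ p\<close>: as
    \<open>\<beta>' = y * m + j * A'\<close>, the expansion of \<open>\<beta>' ^ p\<close> has one
    term containing \<open>y ^ p\<close> and one containing \<open>A'\<close>, and
    \<open>A * A' = y ^ p\<close>.\<close>
  define W W' where "W = A * of_int m ^ p + of_int j * g" and "W' = A' * of_int m ^ p + of_int j * g'"
  have W: "conj_pair W W'"
    unfolding W_def W'_def
    by (intro conj_pair_add conj_pair_mult conj_pair_power conj_pair_of_int A g(1))
  have W1: "A * \<beta>' ^ p = of_int y ^ p * W"
  proof -
    have "\<beta>' = of_int (y * m) + of_int j * A'"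
      by (simp add: \<beta>'_def A'_def ijm(1) algebra_simps)
    hence "A * \<beta>' ^ p = A * (of_int (y * m) ^ p) + (A * A') * (of_int j * g)"
      using g(2) by (simp add: algebra_simps)
    also have "\<dots> = of_int y ^ p * W"
      unfolding AA W_def by (simp add: power_mult_distrib algebra_simps)
    finally show ?thesis .
  qed
  have W2: "A' * \<beta> ^ p = of_int y ^ p * W'"
  proof -
    have "\<beta> = of_int (y * m) + of_int j * A"
      by (simp add: \<beta>_def A_def ijm(1) algebra_simps)
    hence "A' * \<beta> ^ p = A' * (of_int (y * m) ^ p) + (A * A') * (of_int j * g')"
      using g(3) by (simp add: algebra_simps)
    also have "\<dots> = of_int y ^ p * W'"
      unfolding AA W'_def by (simp add: power_mult_distrib algebra_simps)
    finally show ?thesis .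
  qed
  have "of_int y ^ p * of_int y ^ p * \<bar>W * W'\<bar> = \<bar>(of_int y ^ p * W) * (of_int y ^ p * W')\<bar>"
    using y0 by (simp add: abs_mult mult_ac)
  also have "\<dots> = \<bar>A * A'\<bar> * \<bar>\<beta> * \<beta>'\<bar> ^ p"
    unfolding W1[symmetric] W2[symmetric] by (simp add: abs_mult power_abs power_mult_distrib mult_ac)
  also have "\<dots> = of_int y ^ p * of_int y ^ p * 1"
    using y0 by (simp add: \<beta>\<beta> AA)
  finally have WW: "\<bar>W * W'\<bar> = 1" using y0 by simp
  have "of_int y ^ p * (\<bar>W\<bar> * \<bar>\<beta>\<bar> ^ p) = \<bar>A * \<beta>' ^ p\<bar> * \<bar>\<beta>\<bar> ^ p"
    unfolding W1 using y0 by (simp add: abs_mult)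
  also have "\<dots> = \<bar>A\<bar> * \<bar>\<beta> * \<beta>'\<bar> ^ p"
    by (simp add: abs_mult power_abs power_mult_distrib)
  also have "\<dots> = of_int y ^ p * \<bar>A\<bar>" by (simp add: \<beta>\<beta>)
  finally have "\<bar>A\<bar> = \<bar>W\<bar> * \<bar>\<beta>\<bar> ^ p" using y0 by simp
  thus ?thesis
    using that[OF \<beta> \<beta>\<beta> W WW] by (simp add: A_def)
qed

section \<open>Units of the ring of integers of the quadratic field\<close>

text \<open>The conjugate is \<open>1 / V\<close> up to sign, so \<open>V - V'\<close>, which equals
  \<open>2 * v * sqrt 2\<close>, lies below \<open>2 * sqrt 2\<close> and is nonnegative. This
  leaves only \<open>v = 0\<close>.\<close>

lemma unit_in_fundamental_interval:
  assumes "conj_pair V V'" "\<bar>V * V'\<bar> = 1" "1 \<le> V" "V < 1 + sqrt 2"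
  shows "V = 1"
proof -
  obtain u v :: int where uv: "V = of_int u + of_int v * sqrt 2" "V' = of_int u - of_int v * sqrt 2"
    using assms(1) unfolding conj_pair_def by blast
  have s2: "sqrt 2 * sqrt 2 = (2::real)" "sqrt 2 > (1::real)" by simp_all
  have inv: "\<bar>V'\<bar> = 1 / V" using assms(2,3) by (simp add: abs_mult field_simps)
  have iv: "1 / V \<le> 1" "1 / V > sqrt 2 - 1"
  proof -
    show "1 / V \<le> 1" using assms(3) by simp
    have "(sqrt 2 - 1) * V < (sqrt 2 - 1) * (1 + sqrt 2)"
      using assms(4) s2 by (intro mult_strict_left_mono) auto
    also have "\<dots> = 1" by (simp add: algebra_simps)
    finally show "1 / V > sqrt 2 - 1" using assms(3) by (simp add: field_simps)
  qed
  have vv: "2 * of_int v * sqrt 2 = V - V'" by (simp add: uv)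
  have "v = 0"
  proof (cases "V' \<ge> 0")
    case True
    hence V': "V' = 1 / V" using inv by simp
    have "2 * of_int v * sqrt 2 < 2 * sqrt 2"
      using vv V' iv assms(4) s2 by linarith
    hence "v < 1" by simp
    moreover have "2 * of_int v * sqrt 2 \<ge> 0" using vv V' iv assms(3) by linarith
    hence "v \<ge> 0" by (simp add: zero_le_mult_iff)
    ultimately show ?thesis by simp
  next
    case False
    hence V': "V' = - (1 / V)" using inv by simp
    \<comment> \<open>The two numbers are the roots of the quadratic expressing
      \<open>V + 1 / V = 2 * sqrt 2\<close>, and \<open>V\<close> lies strictly between
      them.\<close>
    have "(V - (sqrt 2 - 1)) * (V - (1 + sqrt 2)) < 0"
    proof (rule mult_pos_neg)
      have "sqrt 2 < (2::real)" by (simp add: real_sqrt_less_iff[of 2 4, simplified])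
      thus "V - (sqrt 2 - 1) > 0" using assms(3) by simp
    qed (use assms(4) in simp)
    hence "V * V + 1 < 2 * sqrt 2 * V" by (simp add: algebra_simps)
    hence "V + 1 / V < 2 * sqrt 2" using assms(3) by (simp add: field_simps)
    hence "2 * of_int v * sqrt 2 < 2 * sqrt 2" using vv V' by linarith
    hence "v < 1" by simp
    moreover have "2 * of_int v * sqrt 2 > 0" using vv V' iv assms(3) s2 by linarith
    hence "v > 0" by (simp add: zero_less_mult_iff)
    ultimately show ?thesis by simp
  qed
  hence "V = of_int u" "V' = of_int u" by (simp_all add: uv)
  hence "of_int (\<bar>u * u\<bar>) = (1 :: real)" using assms(2) by simp
  hence "\<bar>u * u\<bar> = 1" by linarith
  hence "u = 1 \<or> u = -1" by (auto simp: abs_mult zmult_eq_1_iff)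
  with \<open>V = of_int u\<close> assms(3) show ?thesis by auto
qed


lemma conj_pair_fundamental_unit_powi: "\<exists>B'. conj_pair ((1 + sqrt 2) powi n) B' \<and> \<bar>(1 + sqrt 2) powi n * B'\<bar> = 1"
proof (cases "n \<ge> 0")
  case True
  have "conj_pair (1 + sqrt 2) (1 - sqrt 2)"
    unfolding conj_pair_def by (rule exI[of _ 1], rule exI[of _ 1]) simp
  from conj_pair_power[OF this] have "conj_pair ((1 + sqrt 2) powi n) ((1 - sqrt 2) ^ nat n)"
    using True by (simp add: power_int_def)
  moreover have "\<bar>(1 + sqrt 2) powi n * (1 - sqrt 2) ^ nat n\<bar> = 1"
  proof -
    have "(1 + sqrt 2) * (1 - sqrt 2) = (-1::real)" by (simp add: algebra_simps)
    thus ?thesis using True by (simp add: power_int_def power_mult_distrib[symmetric] power_abs)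
  qed
  ultimately show ?thesis by blast
next
  case False
  have inv: "inverse (1 + sqrt 2) = sqrt 2 - 1"
    by (rule inverse_unique) (simp add: algebra_simps)
  have "conj_pair (sqrt 2 - 1) (- 1 - sqrt 2)"
    unfolding conj_pair_def by (rule exI[of _ "-1"], rule exI[of _ 1]) simp
  from conj_pair_power[OF this] have "conj_pair ((1 + sqrt 2) powi n) ((- 1 - sqrt 2) ^ nat (- n))"
    using False by (simp add: power_int_def inv)
  moreover have "\<bar>(1 + sqrt 2) powi n * (- 1 - sqrt 2) ^ nat (- n)\<bar> = 1"
  proof -
    have "(sqrt 2 - 1) * (- 1 - sqrt 2) = (-1::real)" by (simp add: algebra_simps)
    thus ?thesis using False by (simp add: power_int_def inv power_mult_distrib[symmetric] power_abs)
  qed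
  ultimately show ?thesis by blast
qed

text \<open>Division by the power of \<open>1 + sqrt 2\<close> whose exponent is the floor of the
  logarithm moves the unit into the fundamental interval.\<close>

lemma unit_eq_power_fundamental:
  assumes "conj_pair W W'" "\<bar>W * W'\<bar> = 1"
  obtains n :: int where "\<bar>W\<bar> = (1 + sqrt 2) powi n"
proof -
  have W0: "\<bar>W\<bar> > 0" using assms(2) by auto
  have abs: "\<exists>W'. conj_pair \<bar>W\<bar> W' \<and> \<bar>\<bar>W\<bar> * W'\<bar> = 1"
    using assms conj_pair_minus[OF assms(1)] by (cases "W \<ge> 0") (force simp: abs_mult)+
  have e: "1 + sqrt 2 > (1::real)" "1 + sqrt 2 \<noteq> (0::real)"
    using real_sqrt_gt_zero[of 2] by linarith+
  define n where "n = \<lfloor>ln \<bar>W\<bar> / ln (1 + sqrt 2)\<rfloor>"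
  define V where "V = \<bar>W\<bar> * (1 + sqrt 2) powi (- n)"
  obtain W'' B where B: "conj_pair \<bar>W\<bar> W''" "\<bar>\<bar>W\<bar> * W''\<bar> = 1"
    "conj_pair ((1 + sqrt 2) powi (- n)) B" "\<bar>(1 + sqrt 2) powi (- n) * B\<bar> = 1"
    using abs conj_pair_fundamental_unit_powi by blast
  have ep: "(1 + sqrt 2) powi (- n) > (0::real)" using e(1) by (intro zero_less_power_int) linarith
  have lnV: "ln V = ln \<bar>W\<bar> - of_int n * ln (1 + sqrt 2)"
  proof -
    have "ln ((1 + sqrt 2) powi (- n)) = of_int (- n) * ln (1 + sqrt 2)"
      using e by (subst powr_real_of_int'[symmetric]) (simp_all add: ln_powr)
    thus ?thesis using W0 ep unfolding V_def by (subst ln_mult) auto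
  qed
  have V0: "V > 0" unfolding V_def using W0 ep by (rule mult_pos_pos)
  have le: "ln (1 + sqrt 2) > (0::real)" using e by (simp add: ln_gt_zero)
  have "of_int n \<le> ln \<bar>W\<bar> / ln (1 + sqrt 2)" "ln \<bar>W\<bar> / ln (1 + sqrt 2) < of_int n + 1"
    unfolding n_def by linarith+
  hence "of_int n * ln (1 + sqrt 2) \<le> ln \<bar>W\<bar>" "ln \<bar>W\<bar> < (of_int n + 1) * ln (1 + sqrt 2)"
    using le by (simp_all add: field_simps)
  hence "ln V \<ge> ln 1" "ln V < ln (1 + sqrt 2)"
    unfolding lnV by (simp_all add: algebra_simps)
  hence V: "1 \<le> V" "V < 1 + sqrt 2" using V0 e by (simp_all add: ln_ge_iff)
  have "V = 1"
  proof (rule unit_in_fundamental_interval[OF _ _ V])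
    show "conj_pair V (W'' * B)" unfolding V_def by (intro conj_pair_mult B)
    have "\<bar>V * (W'' * B)\<bar> = \<bar>\<bar>W\<bar> * W''\<bar> * \<bar>(1 + sqrt 2) powi (- n) * B\<bar>"
      by (simp add: V_def abs_mult mult_ac)
    thus "\<bar>V * (W'' * B)\<bar> = 1" using B by simp
  qed
  hence "\<bar>W\<bar> = (1 + sqrt 2) powi n"
    using e by (simp add: V_def power_int_minus field_simps)
  thus ?thesis by (rule that)
qed

section \<open>From the equation to a small linear form\<close>

text \<open>Modulo 4 an even \<open>y\<close> is impossible. For odd \<open>x\<close> the equation
  gives \<open>y ^ p\<close> congruent to 7 modulo 8, and since \<open>p\<close> is odd, so is
  \<open>y\<close>. A negative \<open>y\<close> other than \<open>-1\<close> would be at most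
  \<open>-9\<close>, against \<open>y ^ p \<ge> -2\<close>.\<close>

lemma exponent_odd_residue:
  fixes x y :: int
  assumes "x\<^sup>2 - 2 = y ^ p" "odd p" "p > 1" "y \<noteq> -1"
  shows "y \<ge> 7 \<and> odd y"
proof -
  have sq: "x\<^sup>2 \<noteq> 2"
    using square_eq_twice_square_int[of x 1] by auto
  have odd: "odd y"
  proof
    assume "even y"
    then obtain k where k: "y = 2 * k" by auto
    obtain q where q: "p = 2 + q" using assms(3) by (metis Suc_1 Suc_leI le_Suc_ex)
    have x2: "x\<^sup>2 = 2 * (2 * (k\<^sup>2 * y ^ q) + 1)"
      using assms(1) by (simp add: q power_add k power2_eq_square algebra_simps)
    hence "even (x\<^sup>2)" by simp
    hence "even x" by simp
    then obtain m where "x = 2 * m" by auto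
    hence "2 * m\<^sup>2 = 2 * (k\<^sup>2 * y ^ q) + 1" using x2 by (simp add: power2_eq_square)
    hence "even (2 * (k\<^sup>2 * y ^ q) + 1)" by (metis dvd_triv_left)
    thus False by simp
  qed
  have "odd (x\<^sup>2)"
  proof -
    have "odd (y ^ p)" using odd by simp
    moreover have "x\<^sup>2 = y ^ p + 2" using assms(1) by simp
    ultimately show ?thesis by simp
  qed
  hence "odd x" by simp
  then obtain m where m: "x = 2 * m + 1" by (auto elim: oddE)
  obtain k where k: "m * (m + 1) = 2 * k"
    using evenE[of "m * (m + 1)"] by auto
  have "x\<^sup>2 = 4 * (m * (m + 1)) + 1" by (simp add: m power2_eq_square algebra_simps)
  hence "y ^ p = 7 + 8 * (k - 1)" using assms(1) k by simp
  hence "y ^ p mod 8 = (7 + 8 * (k - 1)) mod 8" by (simp only:)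
  also have "\<dots> = 7" by (simp only: mod_mult_self2) simp
  finally have yp8: "y ^ p mod 8 = 7" .
  obtain h where h: "y = 2 * h + 1" using odd by (auto elim: oddE)
  obtain k' where k': "h * (h + 1) = 2 * k'"
    using evenE[of "h * (h + 1)"] by auto
  have "y\<^sup>2 = 4 * (h * (h + 1)) + 1" by (simp add: h power2_eq_square algebra_simps)
  hence "y\<^sup>2 = 1 + 8 * k'" using k' by simp
  hence y2: "y\<^sup>2 mod 8 = 1" by simp
  obtain q where q: "p = 2 * q + 1" using assms(2) by (auto elim: oddE)
  have "y ^ p mod 8 = ((y\<^sup>2) ^ q mod 8 * y) mod 8"
  proof -
    have "y ^ p = (y\<^sup>2) ^ q * y" by (simp add: q power_mult[symmetric])
    thus ?thesis by (simp only: mod_mult_left_eq)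
  qed
  also have "(y\<^sup>2) ^ q mod 8 = 1"
    using power_mod[of "y\<^sup>2" 8 q] y2 by simp
  finally have y8: "y mod 8 = 7" using yp8 by simp
  have "y \<ge> 0"
  proof (rule ccontr)
    assume "\<not> y \<ge> 0"
    hence "y \<le> -9" using y8 assms(4) by presburger
    hence "(- y) ^ 1 \<le> (- y) ^ p" using assms(3) by (intro power_increasing) auto
    hence "9 \<le> (- y) ^ p" using \<open>y \<le> -9\<close> by simp
    moreover have "y ^ p \<ge> -2" using assms(1) zero_le_power2[of x] by linarith
    ultimately show False using assms(2) by simp
  qed
  thus ?thesis using y8 odd by presburger
qed

text \<open>Serves to move the multiple of \<open>p\<close> in the exponent of the unit into the
  \<open>p\<close>-th power.\<close>

lemma balanced_residue:
  fixes n :: int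
  assumes "odd p"
  obtains q n0 :: int where "n = int p * q + n0" "2 * \<bar>n0\<bar> < int p"
proof -
  define c where "c = (int p - 1) div 2"
  have c: "int p = 2 * c + 1" using assms unfolding c_def by presburger
  have p: "int p > 0" using assms by (metis dvd_0_right of_nat_0_less_iff gr0I)
  define n0 where "n0 = (n + c) mod int p - c"
  have "0 \<le> n0 + c" "n0 + c < int p" using p by (simp_all add: n0_def)
  hence "2 * \<bar>n0\<bar> < int p" using c by linarith
  moreover have "n = int p * ((n + c) div int p) + n0"
    unfolding n0_def using mult_div_mod_eq[of "int p" "n + c"] by linarith
  ultimately show ?thesis using that by blast
qed

text \<open>The quotient of \<open>A = \<bar>x\<bar> + sqrt 2\<close> and its conjugate is close to
  1, because they differ by \<open>2 * sqrt 2\<close> while their product is \<open>y ^ p\<close>.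
  The factorisation turns its logarithm \<open>\<Lambda>\<close> into the linear form; the sign of
  \<open>n0\<close> decides between \<open>\<theta>\<close> and \<open>- \<theta>\<close>.\<close>

lemma linear_form_reduction:
  fixes x y :: int and p :: nat
  assumes "prime p" "p > 40" "x\<^sup>2 - 2 = y ^ p" "y \<noteq> -1"
  obtains \<theta> :: real and b :: nat
  where "y \<ge> 7" "0 < b" "2 * b < p"
    "conj_pair (of_int y * exp \<theta>) (of_int y * exp (- \<theta>))"
    "\<bar>real p * \<theta> - real b * (2 * ln (1 + sqrt 2))\<bar> \<le> 4 * exp (- (real p / 2 * ln (of_int y)))"
proof -
  have podd: "odd p" using assms(1,2) prime_odd_nat by simp
  have y: "y \<ge> 7" "odd y"
    using exponent_odd_residue[OF assms(3) podd _ assms(4)] assms(2) by auto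
  have cop: "coprime x y"
  proof -
    have "gcd x y dvd x\<^sup>2" "gcd x y dvd y ^ p"
      using assms(2) by (auto simp: power2_eq_square intro: dvd_trans[OF _ dvd_power])
    hence "gcd x y dvd x\<^sup>2 - y ^ p" by (rule dvd_diff)
    moreover have "x\<^sup>2 - y ^ p = 2" using assms(3) by simp
    ultimately have d2: "gcd x y dvd 2" by simp
    hence "gcd x y \<le> 2" by (rule zdvd_imp_le) simp
    moreover have "gcd x y > 0" using y(1) by simp
    moreover have "gcd x y \<noteq> 2" using y(2) by (metis gcd_dvd2)
    ultimately have "gcd x y = 1" by linarith
    thus ?thesis by (simp add: coprime_iff_gcd_eq_1)
  qed
  define X where "X = \<bar>x\<bar>"
  have X: "X\<^sup>2 - 2 = y ^ p" "coprime X y" "X \<ge> 0" using assms(3) cop by (auto simp: X_def)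
  obtain \<beta> \<beta>' W W' where \<beta>: "conj_pair \<beta> \<beta>'" "\<bar>\<beta> * \<beta>'\<bar> = of_int y" "conj_pair W W'" "\<bar>W * W'\<bar> = 1"
    "\<bar>of_int X + sqrt 2\<bar> = \<bar>W\<bar> * \<bar>\<beta>\<bar> ^ p"
  proof -
    have "y > 1" "p > 0" using y(1) assms(2) by auto
    from lebesgue_nagell_factorisation[OF this(1) X(2,1) this(2)] that show ?thesis by blast
  qed
  obtain n where n: "\<bar>W\<bar> = (1 + sqrt 2) powi n" using unit_eq_power_fundamental[OF \<beta>(3,4)] by blast
  obtain q n0 where qn: "n = int p * q + n0" "2 * \<bar>n0\<bar> < int p" using balanced_residue[OF podd] by blast
  define Y where "Y = ln (of_int y :: real)"
  have y0: "(of_int y :: real) > 0" using y(1) by simp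
  have \<beta>0: "\<bar>\<beta>\<bar> > 0" using \<beta>(2) y0 by auto
  have e: "1 + sqrt 2 > (1::real)" "1 + sqrt 2 \<noteq> (0::real)"
    using real_sqrt_gt_zero[of 2] by linarith+
  have e0: "(0::real) < 1 + sqrt 2" using e(1) by linarith
  define \<epsilon> where "\<epsilon> = ln (1 + sqrt 2 :: real)"
  define A A' where "A = of_int X + sqrt 2" and "A' = of_int X - sqrt 2"
  have A0: "A > 0" using X(3) by (simp add: A_def add_nonneg_pos)
  have lnpowi: "ln ((1 + sqrt 2) powi k) = of_int k * \<epsilon>" for k
    using e unfolding \<epsilon>_def by (subst powr_real_of_int'[symmetric]) (simp_all add: ln_powr)
  have lnA: "ln A = of_int n * \<epsilon> + real p * ln \<bar>\<beta>\<bar>"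
    using \<beta>(5) A0 \<beta>0 e unfolding A_def[symmetric] n
    by (simp add: ln_mult ln_realpow lnpowi)
  have AA: "A * A' = of_int y ^ p"
  proof -
    have "A * A' = of_int (X\<^sup>2 - 2)"
      by (simp add: A_def A'_def algebra_simps power2_eq_square)
    thus ?thesis using X(1) by simp
  qed
  \<comment> \<open>The logarithm of
    \<open>(\<beta> * (1 + sqrt 2) powi q)\<^sup>2 / y\<close>.\<close>
  define \<theta> where "\<theta> = 2 * ln \<bar>\<beta>\<bar> - Y + of_int q * (2 * \<epsilon>)"
  define \<Lambda> where "\<Lambda> = 2 * ln A - real p * Y"
  have \<Lambda>: "real p * \<theta> + of_int n0 * (2 * \<epsilon>) = \<Lambda>"
    unfolding \<Lambda>_def lnA qn(1) \<theta>_def by (simp add: algebra_simps)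
  have pair: "conj_pair (of_int y * exp \<theta>) (of_int y * exp (- \<theta>))"
  proof -
    obtain B' where B: "conj_pair ((1 + sqrt 2) powi q) B'" "\<bar>(1 + sqrt 2) powi q * B'\<bar> = 1"
      using conj_pair_fundamental_unit_powi by blast
    have Bp: "(1 + sqrt 2) powi q = exp (of_int q * \<epsilon>)"
      using exp_ln[OF zero_less_power_int[OF e0], of q] lnpowi[of q] by simp
    have 1: "of_int y * exp \<theta> = (\<beta> * (1 + sqrt 2) powi q)\<^sup>2"
    proof -
      have "of_int y * exp \<theta> = of_int y * (exp (ln \<bar>\<beta>\<bar>) ^ 2 / exp Y * exp (of_int q * \<epsilon>) ^ 2)"
      proof -
        have "\<theta> = (ln \<bar>\<beta>\<bar> + ln \<bar>\<beta>\<bar>) - Y + (of_int q * \<epsilon> + of_int q * \<epsilon>)"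
          by (simp add: \<theta>_def)
        thus ?thesis by (simp only: exp_add exp_diff power2_eq_square)
      qed
      thus ?thesis using \<beta>0 y0 by (simp add: Y_def Bp power_mult_distrib)
    qed
    have 2: "of_int y * exp (- \<theta>) = (\<beta>' * B')\<^sup>2"
    proof -
      have "(of_int y * exp \<theta>) * (\<beta>' * B')\<^sup>2 = \<bar>\<beta> * \<beta>'\<bar>\<^sup>2 * \<bar>(1 + sqrt 2) powi q * B'\<bar>\<^sup>2"
        unfolding 1 by (simp add: power_mult_distrib)
      also have "\<dots> = (of_int y)\<^sup>2" using B \<beta> by simp
      finally show ?thesis using y0 by (simp add: exp_minus field_simps power2_eq_square)
    qed
    show ?thesis unfolding 1 2 by (intro conj_pair_power conj_pair_mult \<beta> B)
  qed
  have Ybig: "Y > 0" using y(1) by (simp add: Y_def)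
  have \<Lambda>pos: "\<Lambda> > 0" and \<Lambda>le: "\<Lambda> \<le> 4 * exp (- (real p / 2 * Y))"
  proof -
    have "of_int (y ^ p) \<ge> (7::real) ^ 2"
    proof -
      have "(7::int) ^ 2 \<le> y ^ 2" using y(1) by (intro power_mono) auto
      also have "\<dots> \<le> y ^ p" using y(1) assms(2) by (intro power_increasing) auto
      finally show ?thesis by (metis of_int_le_iff of_int_numeral of_int_power)
    qed
    hence yp: "of_int y ^ p \<ge> (49::real)" by simp
    have s2: "sqrt 2 < (3/2::real)" by (rule real_less_lsqrt) (simp_all add: power2_eq_square)
    have s1: "sqrt 2 > (1::real)" by simp
    \<comment> \<open>Otherwise \<open>A < 6\<close>, and the product would stay below 18, whereas
      it is at least 49.\<close>
    have A'3: "A' \<ge> 3"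
    proof (rule ccontr)
      assume "\<not> A' \<ge> 3"
      hence "A < 6" "A' < 3" using s2 by (simp_all add: A_def A'_def)
      hence "A * A' < 6 * 3 \<or> A' \<le> 0" using A0 by (metis mult_strict_mono not_le order_less_imp_le zero_less_numeral)
      thus False using AA yp A0 mult_nonneg_nonpos[of A A'] by auto
    qed
    have "ln (A * A') = real p * Y" unfolding AA Y_def using y0 by (simp add: ln_realpow)
    hence \<Lambda>eq: "\<Lambda> = ln (A / A')" using A0 A'3 by (simp add: \<Lambda>_def ln_mult ln_div)
    have AA': "A - A' = 2 * sqrt 2" by (simp add: A_def A'_def)
    have "A' < A" using AA' s1 by linarith
    hence "A / A' > 1" using A'3 by simp
    thus "\<Lambda> > 0" unfolding \<Lambda>eq by simp
    have "A \<le> 2 * A'" using AA' A'3 s2 by linarith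
    hence "A * A' \<le> 2 * A' * A'" using A'3 by (intro mult_right_mono) auto
    moreover have "of_int y ^ p = exp (real p / 2 * Y) * exp (real p / 2 * Y)"
    proof -
      have "exp (real p / 2 * Y) * exp (real p / 2 * Y) = exp (real p * Y)"
        by (subst exp_add[symmetric]) simp
      also have "\<dots> = exp Y ^ p" by (rule exp_of_nat_mult)
      finally show ?thesis using y0 by (simp add: Y_def)
    qed
    ultimately have "exp (real p / 2 * Y) ^ 2 \<le> (sqrt 2 * A') ^ 2"
    proof -
      assume "A * A' \<le> 2 * A' * A'" "of_int y ^ p = exp (real p / 2 * Y) * exp (real p / 2 * Y)"
      hence "exp (real p / 2 * Y) ^ 2 \<le> 2 * A' * A'" using AA by (simp only: power2_eq_square)
      also have "\<dots> = (sqrt 2 * A') ^ 2" by (simp add: power_mult_distrib power2_eq_square)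
      finally show ?thesis .
    qed
    hence ex: "exp (real p / 2 * Y) \<le> sqrt 2 * A'"
      by (rule power2_le_imp_le) (use A'3 in simp)
    have "\<Lambda> \<le> A / A' - 1" unfolding \<Lambda>eq using A0 A'3 by (intro ln_le_minus_one) auto
    also have "\<dots> = 2 * sqrt 2 / A'" using AA' A'3 by (simp add: field_simps)
    also have "\<dots> = 4 / (sqrt 2 * A')" using A'3 by (simp add: field_simps)
    also have "\<dots> \<le> 4 / exp (real p / 2 * Y)" using ex A'3 by (intro divide_left_mono) auto
    finally show "\<Lambda> \<le> 4 * exp (- (real p / 2 * Y))" by (simp add: exp_minus field_simps)
  qed
  \<comment> \<open>If \<open>n0 = 0\<close>, then \<open>\<theta>\<close> itself is tiny but
    positive. The irrational part of \<open>y * exp \<theta>\<close> is a positive multiple of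
    \<open>sqrt 2\<close>, which forces
    \<open>y * (exp \<theta> - exp (- \<theta>)) \<ge> 2.8\<close>, while
    \<open>3 * y * \<theta>\<close> is at most \<open>12 / 7\<close>.\<close>
  have n0: "n0 \<noteq> 0"
  proof
    assume "n0 = 0"
    hence \<theta>\<Lambda>: "real p * \<theta> = \<Lambda>" using \<Lambda> by simp
    have \<theta>pos: "\<theta> > 0" using \<theta>\<Lambda> \<Lambda>pos assms(2) by (metis of_nat_0_le_iff zero_less_mult_iff not_less)
    have "1 * \<theta> \<le> real p * \<theta>" using \<theta>pos assms(2) by (intro mult_right_mono) auto
    hence "\<theta> \<le> 4 * exp (- (real p / 2 * Y))" using \<theta>\<Lambda> \<Lambda>le by simp
    also have "\<dots> \<le> 4 * exp (- (20 * Y))" using assms(2) Ybig by simp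
    also have "\<dots> = 4 / of_int y ^ 20"
      using y0 exp_of_nat_mult[of 20 Y] by (simp add: exp_minus Y_def field_simps)
    finally have \<theta>le: "\<theta> \<le> 4 / of_int y ^ 20" .
    have y20: "of_int y ^ 20 \<ge> of_int y * (of_int y :: real)"
      using y(1) power_increasing[of 2 20 "of_int y :: real"] by (simp add: power2_eq_square)
    have yy: "of_int y * 7 \<le> of_int y * (of_int y :: real)" using y(1) by simp
    have "of_int y * 7 \<le> (of_int y :: real) ^ 20" using y20 yy by (rule order.trans[rotated])
    hence y7: "(4::real) / of_int y ^ 20 \<le> 4 / (of_int y * 7)"
      using y0 by (intro divide_left_mono mult_pos_pos) auto
    with \<theta>le have "\<theta> \<le> 4 / (of_int y * 7)" by linarith
    hence \<theta>y: "of_int y * \<theta> \<le> 4 / 7" using y0 by (simp add: field_simps)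
    have "4 / (of_int y * 7) \<le> (1::real)" using y(1) by simp
    hence \<theta>1: "\<theta> \<le> 1" using \<theta>le y7 by linarith
    obtain u v :: int where uv: "of_int y * exp \<theta> = of_int u + of_int v * sqrt 2"
        "of_int y * exp (- \<theta>) = of_int u - of_int v * sqrt 2"
      using pair unfolding conj_pair_def by blast
    have d: "2 * of_int v * sqrt 2 = of_int y * (exp \<theta> - exp (- \<theta>))"
      using uv by (simp add: algebra_simps)
    have "exp \<theta> - exp (- \<theta>) > 0" using \<theta>pos by simp
    hence "2 * of_int v * sqrt 2 > 0" unfolding d using y0 by simp
    hence "v \<ge> 1" by (simp add: zero_less_mult_iff)
    hence "2 * of_int v * sqrt 2 \<ge> 2 * 1 * sqrt 2" by (intro mult_mono) auto
    moreover have "sqrt 2 > (1.4::real)" by (rule real_less_rsqrt) (simp add: power2_eq_square)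
    moreover have "exp \<theta> \<le> 1 + \<theta> + \<theta>\<^sup>2" using \<theta>pos \<theta>1 by (intro exp_bound) auto
    moreover have "\<theta>\<^sup>2 \<le> \<theta>" using \<theta>pos \<theta>1 by (simp add: power2_eq_square mult_left_le)
    moreover have "exp (- \<theta>) \<ge> 1 - \<theta>" using exp_ge_add_one_self[of "- \<theta>"] by simp
    ultimately have "2.8 \<le> of_int y * (exp \<theta> - exp (- \<theta>))" "exp \<theta> - exp (- \<theta>) \<le> 3 * \<theta>"
      using d by linarith+
    moreover have "of_int y * (exp \<theta> - exp (- \<theta>)) \<le> of_int y * (3 * \<theta>)"
      using calculation(2) y0 by (intro mult_left_mono) auto
    ultimately show False using \<theta>y by linarith
  qed
  show ?thesis
  proof (cases "n0 < 0")
    case True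
    have "\<bar>real p * \<theta> - real (nat (- n0)) * (2 * \<epsilon>)\<bar> = \<Lambda>"
      using \<Lambda> \<Lambda>pos True by simp
    thus ?thesis
      using that[of "nat (- n0)" \<theta>] True qn(2) y(1) pair \<Lambda>le unfolding \<epsilon>_def Y_def by auto
  next
    case False
    have "\<bar>real p * (- \<theta>) - real (nat n0) * (2 * \<epsilon>)\<bar> = \<Lambda>"
      using \<Lambda> \<Lambda>pos False by simp
    thus ?thesis
      using that[of "nat n0" "- \<theta>"] False n0 qn(2) y(1) conj_pair_sym[OF pair] \<Lambda>le unfolding \<epsilon>_def Y_def by auto
  qed
qed

section \<open>The interpolation determinant\<close>

text \<open>A column index \<open>j\<close> encodes the pair of a binomial index
  \<open>k = j mod K\<close> and a frequency index \<open>l = j div K\<close>.\<close>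

lemma sum_mod_div:
  fixes F :: "nat \<Rightarrow> nat \<Rightarrow> 'a::comm_monoid_add"
  assumes "K > 0"
  shows "(\<Sum>j<K * L. F (j mod K) (j div K)) = (\<Sum>l<L. \<Sum>k<K. F k l)"
proof -
  have "(\<Sum>j<K * L. F (j mod K) (j div K)) = (\<Sum>l<L. \<Sum>j=l * K..<l * K + K. F (j mod K) (j div K))"
    by (simp add: sum.nat_group mult.commute)
  also have "\<dots> = (\<Sum>l<L. \<Sum>k<K. F k l)"
  proof (rule sum.cong[OF refl])
    fix l
    have "(\<Sum>j=l * K..<l * K + K. F (j mod K) (j div K))
        = (\<Sum>k=0..<K. F ((k + l * K) mod K) ((k + l * K) div K))"
      using sum.shift_bounds_nat_ivl[of "\<lambda>j. F (j mod K) (j div K)" 0 "l * K" K] by (simp add: add.commute)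
    also have "\<dots> = (\<Sum>k<K. F k l)"
      using assms by (intro sum.cong) auto
    finally show "(\<Sum>j=l * K..<l * K + K. F (j mod K) (j div K)) = (\<Sum>k<K. F k l)" .
  qed
  finally show ?thesis .
qed

lemma prod_mod_div:
  fixes F :: "nat \<Rightarrow> 'a::comm_monoid_mult"
  assumes "K > 0"
  shows "(\<Prod>j<K * L. F (j mod K)) = (\<Prod>k<K. F k) ^ L"
proof -
  have "(\<Prod>j<K * L. F (j mod K)) = (\<Prod>l<L. \<Prod>j=l * K..<l * K + K. F (j mod K))"
    by (simp add: prod.nat_group mult.commute)
  also have "\<dots> = (\<Prod>l<L. \<Prod>k<K. F k)"
  proof (rule prod.cong[OF refl])
    fix l
    have "(\<Prod>j=l * K..<l * K + K. F (j mod K)) = (\<Prod>k=0..<K. F ((k + l * K) mod K))"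
      using prod.shift_bounds_nat_ivl[of "\<lambda>j. F (j mod K)" 0 "l * K" K] by (simp add: add.commute)
    also have "\<dots> = (\<Prod>k<K. F k)"
      using assms by (intro prod.cong) auto
    finally show "(\<Prod>j=l * K..<l * K + K. F (j mod K)) = (\<Prod>k<K. F k)" .
  qed
  finally show ?thesis by simp
qed

lemma sum_symmetric_squares:
  "(\<Sum>s\<in>{- int n..int n}. (of_int s)\<^sup>2) = (real n * (real n + 1) * (2 * real n + 1) / 3 :: real)"
proof (induction n)
  case (Suc n)
  have "{- int (Suc n)..int (Suc n)} = insert (- int (Suc n)) (insert (int (Suc n)) {- int n..int n})"
    by auto
  hence "(\<Sum>s\<in>{- int (Suc n)..int (Suc n)}. (of_int s)\<^sup>2 :: real)
      = 2 * (real (Suc n))\<^sup>2 + (\<Sum>s\<in>{- int n..int n}. (of_int s)\<^sup>2)"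
    by (simp add: power2_eq_square algebra_simps)
  thus ?case unfolding Suc.IH by (simp add: field_simps power2_eq_square)
qed simp

lemma sum_symmetric_odd: "(\<Sum>s\<in>{- int n..int n}. of_int s) = (0::real)"
proof (induction n)
  case (Suc n)
  have "{- int (Suc n)..int (Suc n)} = insert (- int (Suc n)) (insert (int (Suc n)) {- int n..int n})"
    by auto
  thus ?case using Suc.IH by simp
qed simp

text \<open>The mixed terms cancel because the box is symmetric.\<close>

lemma sum_lattice_squares:
  fixes p b :: real
  shows "(\<Sum>(r, s)\<in>{- int A..int A} \<times> {- int C..int C}. (of_int r * p + of_int s * b)\<^sup>2)
    = (2 * real A + 1) * (2 * real C + 1) * (p\<^sup>2 * (real A * (real A + 1)) + b\<^sup>2 * (real C * (real C + 1))) / 3"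
proof -
  have "(\<Sum>(r, s)\<in>{- int A..int A} \<times> {- int C..int C}. (of_int r * p + of_int s * b)\<^sup>2)
     = (\<Sum>r\<in>{- int A..int A}. \<Sum>s\<in>{- int C..int C}.
          p\<^sup>2 * (of_int r)\<^sup>2 + 2 * p * b * of_int r * of_int s + b\<^sup>2 * (of_int s)\<^sup>2)"
    unfolding sum.cartesian_product[symmetric]
    by (intro sum.cong refl) (simp add: power2_eq_square algebra_simps)
  also have "\<dots> = (\<Sum>r\<in>{- int A..int A}. (2 * real C + 1) * (p\<^sup>2 * (of_int r)\<^sup>2)
      + b\<^sup>2 * (real C * (real C + 1) * (2 * real C + 1) / 3))"
    by (simp add: sum.distrib sum_distrib_left[symmetric] sum_symmetric_odd sum_symmetric_squares)
  also have "\<dots> = (2 * real C + 1) * (p\<^sup>2 * (real A * (real A + 1) * (2 * real A + 1) / 3))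
      + (2 * real A + 1) * (b\<^sup>2 * (real C * (real C + 1) * (2 * real C + 1) / 3))"
    by (simp add: sum.distrib sum_distrib_left[symmetric] sum_symmetric_squares)
  finally show ?thesis by (simp add: field_simps)
qed

text \<open>Gives bounds uniform in the permutation, both for the exponent of \<open>y\<close> in
  the denominator and for the growth of the exponentials.\<close>

lemma cauchy_schwarz_le_sqrt:
  fixes f g :: "'a \<Rightarrow> real"
  assumes "(\<Sum>i\<in>I. (f i)\<^sup>2) \<le> U" "(\<Sum>i\<in>I. (g i)\<^sup>2) \<le> V"
  shows "\<bar>\<Sum>i\<in>I. f i * g i\<bar> \<le> sqrt (U * V)"
proof (rule real_le_rsqrt)
  have "\<bar>\<Sum>i\<in>I. f i * g i\<bar>\<^sup>2 \<le> (\<Sum>i\<in>I. (f i)\<^sup>2) * (\<Sum>i\<in>I. (g i)\<^sup>2)"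
    using Cauchy_Schwarz_ineq_sum[of f g I] by simp
  also have "\<dots> \<le> U * V"
    using assms by (intro mult_mono sum_nonneg order.trans[OF sum_nonneg assms(1)]) auto
  finally show "\<bar>\<Sum>i\<in>I. f i * g i\<bar>\<^sup>2 \<le> U * V" .
qed

section \<open>Conjugates of the exponentials\<close>

text \<open>The base is \<open>3 + 2 * sqrt 2\<close>, a unit of norm 1, so its conjugate is its
  inverse.\<close>

lemma conj_pair_exp_unit:
  "conj_pair (exp (of_int a * (2 * ln (1 + sqrt 2)))) (exp (- (of_int a * (2 * ln (1 + sqrt 2)))))"
proof -
  have e0: "(0::real) < 1 + sqrt 2" by (simp add: add_pos_pos)
  have e1: "exp (2 * ln (1 + sqrt 2)) = 3 + 2 * sqrt 2"
    using e0 by (simp add: exp_double power2_eq_square algebra_simps)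
  have e2: "exp (- (2 * ln (1 + sqrt 2))) = 3 - 2 * sqrt 2"
    unfolding exp_minus e1 by (rule inverse_unique) (simp add: algebra_simps)
  have pr: "conj_pair (3 + 2 * sqrt 2) (3 - 2 * sqrt 2)"
    unfolding conj_pair_def by (rule exI[of _ 3], rule exI[of _ 2]) simp
  have nat: "conj_pair (exp (real n * (2 * ln (1 + sqrt 2)))) (exp (- (real n * (2 * ln (1 + sqrt 2)))))" for n
    using conj_pair_power[OF pr, of n]
    unfolding e1[symmetric] e2[symmetric] exp_of_nat_mult[symmetric] by simp
  show ?thesis
  proof (cases "a \<ge> 0")
    case True
    thus ?thesis using nat[of "nat a"] by simp
  next
    case False
    thus ?thesis using conj_pair_sym[OF nat[of "nat (- a)"]] by simp
  qed
qed

text \<open>Each factor \<open>exp \<theta>\<close> or its inverse needs one factor \<open>y\<close>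
  to become integral; the remaining factors \<open>y\<close> are integers anyway.\<close>

lemma conj_pair_exp_scaled:
  fixes y m :: int and M :: nat
  assumes "conj_pair (of_int y * exp \<theta>) (of_int y * exp (- \<theta>))" "\<bar>m\<bar> \<le> int M"
  shows "conj_pair (of_int y ^ M * exp (of_int m * \<theta>)) (of_int y ^ M * exp (- (of_int m * \<theta>)))"
proof -
  have nat: "conj_pair (of_int y ^ M * exp (real n * t)) (of_int y ^ M * exp (- (real n * t)))"
    if "n \<le> M" and t: "conj_pair (of_int y * exp t) (of_int y * exp (- t))" for n t
  proof -
    have "conj_pair (of_int (y ^ (M - n)) * (of_int y * exp t) ^ n)
        (of_int (y ^ (M - n)) * (of_int y * exp (- t)) ^ n)"
      by (intro conj_pair_mult conj_pair_of_int conj_pair_power t)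
    moreover have "of_int (y ^ (M - n)) * (of_int y * exp u) ^ n = of_int y ^ M * exp (real n * u)" for u :: real
      using that(1) by (simp add: power_mult_distrib exp_of_nat_mult flip: power_add mult.assoc)
    ultimately show ?thesis by simp
  qed
  show ?thesis
  proof (cases "m \<ge> 0")
    case True
    thus ?thesis using nat[of "nat m" \<theta>] assms by simp
  next
    case False
    thus ?thesis using nat[of "nat (- m)" "- \<theta>"] assms conj_pair_sym[OF assms(1)] by simp
  qed
qed

text \<open>Being fixed or negated by conjugation makes \<open>Z\<close> an integer or an integer
  multiple of \<open>sqrt 2\<close>.\<close>

lemma conj_pair_self_abs_ge_1:
  assumes "conj_pair Z Z'" "Z' = Z \<or> Z' = - Z" "Z \<noteq> 0"
  shows "\<bar>Z\<bar> \<ge> 1"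
proof -
  obtain u v :: int where uv: "Z = of_int u + of_int v * sqrt 2" "Z' = of_int u - of_int v * sqrt 2"
    using assms(1) unfolding conj_pair_def by blast
  from assms(2) show ?thesis
  proof
    assume "Z' = Z"
    hence "v = 0" using uv by simp
    thus ?thesis using uv assms(3) by (auto simp flip: of_int_abs)
  next
    assume "Z' = - Z"
    hence "u = 0" using uv by simp
    hence Z: "\<bar>Z\<bar> = of_int \<bar>v\<bar> * sqrt 2" using uv by (simp add: abs_mult)
    have "\<bar>v\<bar> \<ge> 1" using uv \<open>u = 0\<close> assms(3) by auto
    hence "of_int \<bar>v\<bar> * sqrt 2 \<ge> 1 * 1" by (intro mult_mono) auto
    thus ?thesis using Z by simp
  qed
qed

lemma norm_gbinomial_le:
  fixes z :: complex
  assumes "norm z \<le> r" "k \<le> K"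
  shows "norm (z gchoose k) \<le> (r + real K) ^ k / fact k"
proof -
  have "norm (z gchoose k) = (\<Prod>i=0..<k. norm (z - of_nat i)) / fact k"
    by (simp add: gbinomial_prod_rev norm_divide prod_norm)
  also have "\<dots> \<le> (\<Prod>i=0..<k. r + real K) / fact k"
  proof (intro divide_right_mono prod_mono conjI)
    fix i assume "i \<in> {0..<k}"
    thus "norm (z - of_nat i) \<le> r + real K"
      using norm_triangle_ineq4[of z "of_nat i"] assms by simp
  qed auto
  finally show ?thesis by simp
qed

lemma abs_exp_minus_1_le:
  fixes t :: real
  assumes "\<bar>t\<bar> \<le> T"
  shows "\<bar>exp t - 1\<bar> \<le> exp T - 1"
proof (cases "t \<ge> 0")
  case True
  thus ?thesis using assms by simp
next
  case False
  have "1 - exp t \<le> - t" using exp_ge_add_one_self[of t] by linarith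
  also have "\<dots> \<le> T" using assms by simp
  also have "\<dots> \<le> exp T - 1" using exp_ge_add_one_self[of T] by linarith
  finally show ?thesis using False by simp
qed

section \<open>Nonvanishing, lower bound and upper bound of the determinant\<close>

text \<open>Grouping a linear combination by frequency gives polynomials of degree below
  \<open>K\<close>, not all zero by independence of the binomial polynomials, so the zero estimate
  applies.\<close>

lemma interpolation_nonzero_minor:
  fixes p b H K a C :: nat and \<theta>1 \<theta>2 :: real
  assumes "\<theta>1 > 0" "coprime b p" "2 * C < p" "K > 0"
    and count: "K * (2 * H + 1) \<le> (2 * a + 1) * (2 * C + 1)"
  defines "g \<equiv> \<lambda>j (r, s). (of_int (r * int p + s * int b) gchoose (j mod K))
      * exp ((real (j div K) - real H) * (of_int r * \<theta>1 + of_int s * \<theta>2))"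
  shows "\<exists>P. (\<forall>i<K * (2 * H + 1). P i \<in> {- int (a + H)..int (a + H)} \<times> {- int C..int C}) \<and>
    fdet (K * (2 * H + 1)) (\<lambda>i j. g j (P i)) \<noteq> (0::real)"
proof (rule exists_nonzero_minor)
  fix c :: "nat \<Rightarrow> real"
  assume "\<exists>j<K * (2 * H + 1). c j \<noteq> 0"
  then obtain j0 where j0: "j0 < K * (2 * H + 1)" "c j0 \<noteq> 0" by blast
  define P where "P l = (\<Sum>k<K. Polynomial.smult (c (l * K + k)) (gbinomial_poly k))" for l
  have deg: "degree (P l) < K" for l
    unfolding P_def using assms(4)
    by (intro degree_sum_less) (auto intro: le_less_trans[OF degree_smult_le] le_less_trans[OF degree_gbinomial_poly_le])
  have "j0 div K < 2 * H + 1" using j0(1) by (simp add: less_mult_imp_div_less mult.commute)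
  moreover have "P (j0 div K) \<noteq> 0"
  proof
    assume "P (j0 div K) = 0"
    hence "c (j0 div K * K + j0 mod K) = 0"
      unfolding P_def by (rule gbinomial_poly_independent) (use assms(4) in simp)
    with j0(2) show False by simp
  qed
  ultimately have "\<exists>r s. \<bar>r\<bar> \<le> int (a + H) \<and> \<bar>s\<bar> \<le> int C \<and>
    (\<Sum>l<2 * H + 1. poly (P l) (of_int (r * int p + s * int b))
       * exp ((real l - real H) * (of_int r * \<theta>1 + of_int s * \<theta>2))) \<noteq> 0"
    by (intro zero_estimate[where K = K, OF assms(1) _ _ assms(4) count deg])
       (use assms(2,3) in \<open>auto simp: coprime_int_iff\<close>)
  then obtain r s where rs: "\<bar>r\<bar> \<le> int (a + H)" "\<bar>s\<bar> \<le> int C"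
    "(\<Sum>l<2 * H + 1. poly (P l) (of_int (r * int p + s * int b))
       * exp ((real l - real H) * (of_int r * \<theta>1 + of_int s * \<theta>2))) \<noteq> 0" by blast
  have "(\<Sum>j<K * (2 * H + 1). c j * g j (r, s))
      = (\<Sum>j<K * (2 * H + 1). c (j div K * K + j mod K) * ((of_int (r * int p + s * int b) gchoose (j mod K))
      * exp ((real (j div K) - real H) * (of_int r * \<theta>1 + of_int s * \<theta>2))))"
    by (simp add: g_def)
  also have "\<dots> = (\<Sum>l<2 * H + 1. \<Sum>k<K. c (l * K + k) * ((of_int (r * int p + s * int b) gchoose k)
      * exp ((real l - real H) * (of_int r * \<theta>1 + of_int s * \<theta>2))))"
    by (rule sum_mod_div[OF assms(4)])
  also have "\<dots> = (\<Sum>l<2 * H + 1. poly (P l) (of_int (r * int p + s * int b))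
       * exp ((real l - real H) * (of_int r * \<theta>1 + of_int s * \<theta>2)))"
    by (intro sum.cong refl) (simp add: P_def poly_sum poly_gbinomial_poly sum_distrib_right mult.assoc)
  finally have "(\<Sum>j<K * (2 * H + 1). c j * g j (r, s)) \<noteq> 0" using rs(3) by simp
  moreover have "(r, s) \<in> {- int (a + H)..int (a + H)} \<times> {- int C..int C}" using rs(1,2) by auto
  ultimately show "\<exists>x\<in>{- int (a + H)..int (a + H)} \<times> {- int C..int C}.
      (\<Sum>j<K * (2 * H + 1). c j * g j x) \<noteq> 0" by blast
qed

text \<open>
  Conjugation inverts both exponentials, hence only permutes the columns by \<open>l \<mapsto> - l\<close>. After
  clearing denominators the determinant is therefore an integer or an integer multiple of \<open>\<surd>2\<close>,
  and no estimate of its conjugate is needed.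
\<close>

lemma determinant_abs_lower_bound:
  fixes y :: int and p b H K M :: nat and P :: "nat \<Rightarrow> int \<times> int" and \<theta> :: real
  defines "N \<equiv> K * (2 * H + 1)" and "\<theta>1 \<equiv> 2 * ln (1 + sqrt 2)"
  defines "g \<equiv> \<lambda>j (r, s). (of_int (r * int p + s * int b) gchoose (j mod K))
      * exp ((real (j div K) - real H) * (of_int r * \<theta>1 + of_int s * \<theta>))"
  assumes pair: "conj_pair (of_int y * exp \<theta>) (of_int y * exp (- \<theta>))"
    and K: "K > 0" and y: "y > 0"
    and M: "\<And>\<sigma>. \<sigma> permutes {0..<N} \<Longrightarrow>
        \<bar>\<Sum>i=0..<N. (int (\<sigma> i div K) - int H) * snd (P i)\<bar> \<le> int M"
    and nz: "fdet N (\<lambda>i j. g j (P i)) \<noteq> (0::real)"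
  shows "of_int y ^ M * \<bar>fdet N (\<lambda>i j. g j (P i))\<bar> \<ge> 1"
proof -
  define l where "l j = int (j div K) - int H" for j
  define B where "B i j = \<lfloor>(of_int (fst (P i) * int p + snd (P i) * int b) :: real) gchoose (j mod K)\<rfloor>" for i j
  have B: "of_int (B i j) = (of_int (fst (P i) * int p + snd (P i) * int b) :: real) gchoose (j mod K)" for i j
    unfolding B_def of_int_gbinomial[symmetric] floor_of_int ..
  define w where "w i = of_int (fst (P i)) * \<theta>1 + of_int (snd (P i)) * \<theta>" for i
  have g: "g j (P i) = of_int (B i j) * exp (of_int (l j) * w i)" for i j
    by (cases "P i") (simp add: g_def B l_def w_def)
  define g' where "g' j i = of_int (B i j) * exp (- (of_int (l j) * w i))" for i j
  define Z Z' where "Z = of_int y ^ M * fdet N (\<lambda>i j. g j (P i))" and "Z' = of_int y ^ M * fdet N (\<lambda>i j. g' j i)"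
  have ZZ: "conj_pair Z Z'"
  proof -
    \<comment> \<open>Each Leibniz term is the integer \<open>\<kappa> \<sigma>\<close> times the
      exponential of \<open>m1 \<sigma> * \<theta>1 + m2 \<sigma> * \<theta>\<close>; only the
      second part has a denominator, cleared by \<open>y ^ M\<close>.\<close>
    define \<kappa> where "\<kappa> \<sigma> = sign \<sigma> * (\<Prod>i=0..<N. B i (\<sigma> i))" for \<sigma>
    define m1 where "m1 \<sigma> = (\<Sum>i=0..<N. l (\<sigma> i) * fst (P i))" for \<sigma>
    define m2 where "m2 \<sigma> = (\<Sum>i=0..<N. l (\<sigma> i) * snd (P i))" for \<sigma>
    have W: "(\<Sum>i=0..<N. of_int (l (\<sigma> i)) * w i) = of_int (m1 \<sigma>) * \<theta>1 + of_int (m2 \<sigma>) * \<theta>" for \<sigma>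
      by (simp add: m1_def m2_def w_def sum_distrib_left algebra_simps sum.distrib)
    have 1: "Z = (\<Sum>\<sigma> | \<sigma> permutes {0..<N}. of_int (\<kappa> \<sigma>) *
        (exp (of_int (m1 \<sigma>) * \<theta>1) * (of_int y ^ M * exp (of_int (m2 \<sigma>) * \<theta>))))"
      unfolding Z_def fdet_expand g sum_distrib_left prod.distrib exp_sum[OF finite_atLeastLessThan, symmetric] W exp_add
      by (intro sum.cong refl) (simp add: \<kappa>_def mult_ac)
    have 2: "Z' = (\<Sum>\<sigma> | \<sigma> permutes {0..<N}. of_int (\<kappa> \<sigma>) *
        (exp (- (of_int (m1 \<sigma>) * \<theta>1)) * (of_int y ^ M * exp (- (of_int (m2 \<sigma>) * \<theta>)))))"
      unfolding Z'_def fdet_expand g'_def sum_distrib_left prod.distrib exp_sum[OF finite_atLeastLessThan, symmetric]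
        sum_negf W minus_add_distrib exp_add
      by (intro sum.cong refl) (simp add: \<kappa>_def mult_ac)
    show ?thesis
      unfolding 1 2 \<theta>1_def
    proof (rule conj_pair_sum)
      fix \<sigma> assume "\<sigma> \<in> {\<sigma>. \<sigma> permutes {0..<N}}"
      hence "\<bar>m2 \<sigma>\<bar> \<le> int M" using M unfolding m2_def l_def by simp
      thus "conj_pair
          (of_int (\<kappa> \<sigma>) * (exp (of_int (m1 \<sigma>) * (2 * ln (1 + sqrt 2)))
            * (of_int y ^ M * exp (of_int (m2 \<sigma>) * \<theta>))))
          (of_int (\<kappa> \<sigma>) * (exp (- (of_int (m1 \<sigma>) * (2 * ln (1 + sqrt 2))))
            * (of_int y ^ M * exp (- (of_int (m2 \<sigma>) * \<theta>)))))"
        by (rule conj_pair_mult[OF conj_pair_of_int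
              conj_pair_mult[OF conj_pair_exp_unit conj_pair_exp_scaled[OF pair]]])
    qed
  qed
  \<comment> \<open>The column permutation that reverses the frequency and keeps the binomial index;
    it is the identity outside the index range.\<close>
  define \<pi> where "\<pi> j = (if j < N then j mod K + K * (2 * H - j div K) else j)" for j
  have dm: "\<pi> j div K = 2 * H - j div K" "\<pi> j mod K = j mod K" "\<pi> j < N" "j div K \<le> 2 * H" if "j < N" for j
  proof -
    show "\<pi> j div K = 2 * H - j div K" "\<pi> j mod K = j mod K" using that K by (auto simp: \<pi>_def)
    show "j div K \<le> 2 * H" using that K less_mult_imp_div_less[of j "2 * H + 1" K] by (simp add: N_def mult.commute)
    have "\<pi> j < K + K * (2 * H - j div K)" using that K by (simp add: \<pi>_def)
    also have "\<dots> \<le> K + K * (2 * H)" by simp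
    finally show "\<pi> j < N" by (simp add: N_def algebra_simps)
  qed
  have inv: "\<pi> (\<pi> j) = j" for j
  proof (cases "j < N")
    case True
    have "\<pi> (\<pi> j) = \<pi> j mod K + K * (2 * H - \<pi> j div K)" using dm(3)[OF True] by (simp add: \<pi>_def)
    also have "\<dots> = j mod K + K * (j div K)" using dm[OF True] by simp
    finally show ?thesis by simp
  qed (simp add: \<pi>_def)
  have perm: "\<pi> permutes {0..<N}"
    by (rule bij_imp_permutes) (auto intro!: bij_betwI[where g = \<pi>] simp: inv dm(3), auto simp: \<pi>_def)
  have "fdet N (\<lambda>i j. g' j i) = fdet N (\<lambda>i j. g (\<pi> j) (P i))"
  proof (rule fdet_cong)
    fix i j assume "i < N" "j < N"
    have "l (\<pi> j) = - l j" using dm[OF \<open>j < N\<close>] by (simp add: l_def of_nat_diff)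
    moreover have "B i (\<pi> j) = B i j" using dm[OF \<open>j < N\<close>] by (simp add: B_def)
    ultimately show "g' j i = g (\<pi> j) (P i)" by (simp add: g g'_def)
  qed
  also have "\<dots> = of_int (sign \<pi>) * fdet N (\<lambda>i j. g j (P i))"
    by (rule fdet_permute_cols[OF perm])
  finally have "Z' = Z \<or> Z' = - Z"
    unfolding Z_def Z'_def by (cases "sign \<pi> = 1") (auto simp: sign_def)
  moreover have "Z \<noteq> 0" using nz y by (simp add: Z_def)
  ultimately have "\<bar>Z\<bar> \<ge> 1" using conj_pair_self_abs_ge_1[OF ZZ] by blast
  thus ?thesis using y by (simp add: Z_def abs_mult)
qed

text \<open>Were the linear form zero, each exponent would be a multiple of the single number
  \<open>X = r * p + s * b\<close>, and the entries would be values of entire functions of one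
  variable at the \<open>X i\<close>. The actual entries differ by factors
  \<open>1 + \<delta> i j\<close>, controlled by \<open>\<Lambda>\<close>.\<close>

lemma determinant_abs_upper_bound:
  fixes p b H K A C :: nat and P :: "nat \<Rightarrow> int \<times> int" and \<theta> \<theta>1 \<rho> \<Lambda> :: real
  defines "N \<equiv> K * (2 * H + 1)"
  defines "g \<equiv> \<lambda>j (r, s). (of_int (r * int p + s * int b) gchoose (j mod K))
      * exp ((real (j div K) - real H) * (of_int r * \<theta>1 + of_int s * \<theta>))"
  assumes "p > 0" "K > 0" "\<rho> > 1" "\<theta>1 > 0"
    and P: "\<And>i. i < N \<Longrightarrow> P i \<in> {- int A..int A} \<times> {- int C..int C}"
    and \<Lambda>: "\<bar>real p * \<theta> - real b * \<theta>1\<bar> \<le> \<Lambda>"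
    and small: "\<rho> ^ N * (exp (real H * real C * \<Lambda> / real p) - 1) \<le> 1 / real N"
    and T: "\<And>\<sigma>. \<sigma> permutes {0..<N} \<Longrightarrow> (\<Sum>i=0..<N. \<bar>real (i div K) - real H\<bar>
        * \<bar>of_int (fst (P (\<sigma> i)) * int p + snd (P (\<sigma> i)) * int b)\<bar>) \<le> T"
  shows "\<bar>fdet N (\<lambda>i j. g j (P i))\<bar> * \<rho> ^ (\<Sum>n<N. n)
    \<le> fact N * (exp 1 * ((\<Prod>k<K. (\<rho> * (real A * real p + real C * real b) + real K) ^ k / fact k) ^ (2 * H + 1)
        * exp (\<rho> * \<theta>1 / real p * T)))"
proof -
  define l where "l j = real (j div K) - real H" for j
  define X where "X i = fst (P i) * int p + snd (P i) * int b" for i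
  define c where "c = \<theta>1 / real p"
  have c0: "c > 0" using assms(3,6) by (simp add: c_def)
  \<comment> \<open>The error made when \<open>\<theta>\<close> is replaced by
    \<open>b * \<theta>1 / p\<close>.\<close>
  define \<mu> where "\<mu> = (real p * \<theta> - real b * \<theta>1) / real p"
  define f where "f j z = (z gchoose (j mod K)) * exp (of_real (l j * c) * z)" for j and z :: complex
  define \<delta> where "\<delta> i j = complex_of_real (exp (l j * of_int (snd (P i)) * \<mu>) - 1)" for i j
  have entry: "of_real (g j (P i)) = f j (of_int (X i)) * (1 + \<delta> i j)" for i j
  proof -
    obtain r s where rs: "P i = (r, s)" by (cases "P i")
    have "of_int r * \<theta>1 + of_int s * \<theta> = c * of_int (X i) + of_int s * \<mu>"
      using assms(3) by (simp add: c_def X_def rs \<mu>_def field_simps)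
    hence *: "l j * (of_int r * \<theta>1 + of_int s * \<theta>) = l j * c * of_int (X i) + l j * of_int s * \<mu>"
      by (simp only: ring_distribs mult.assoc)
    have "g j (P i) = (of_int (X i) gchoose (j mod K)) * exp (l j * (of_int r * \<theta>1 + of_int s * \<theta>))"
      by (simp add: g_def rs X_def l_def)
    hence "g j (P i) = (of_int (X i) gchoose (j mod K)) * (exp (l j * c * of_int (X i)) * exp (l j * of_int s * \<mu>))"
      unfolding * exp_add .
    moreover have "complex_of_real (of_int (X i) gchoose (j mod K)) = of_int (X i) gchoose (j mod K)"
      by (simp add: gbinomial_prod_rev)
    ultimately show ?thesis
      by (simp add: f_def \<delta>_def rs exp_of_real[symmetric])
  qed
  have N0: "N > 0" using assms(4) by (simp add: N_def)
  have lH: "\<bar>l j\<bar> \<le> real H" if "j < N" for j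
  proof -
    have "j div K < 2 * H + 1" using that less_mult_imp_div_less[of j "2 * H + 1" K]
      by (simp add: N_def mult.commute)
    thus ?thesis unfolding l_def by linarith
  qed
  define X0 where "X0 = real A * real p + real C * real b"
  have XX0: "\<bar>of_int (X i)\<bar> \<le> X0" if "i < N" for i
  proof -
    have "\<bar>fst (P i)\<bar> \<le> int A" "\<bar>snd (P i)\<bar> \<le> int C" using P[OF that] by (auto simp: mem_Times_iff)
    hence *: "\<bar>real_of_int (fst (P i))\<bar> \<le> real A" "\<bar>real_of_int (snd (P i))\<bar> \<le> real C" by linarith+
    have "\<bar>real_of_int (X i)\<bar> \<le> \<bar>of_int (fst (P i)) * real p\<bar> + \<bar>of_int (snd (P i)) * real b\<bar>"
      unfolding X_def by simp
    also have "\<dots> \<le> X0"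
      unfolding X0_def abs_mult using * by (intro add_mono mult_mono) auto
    finally show ?thesis .
  qed
  have "norm (fdet N (\<lambda>i j. f j (of_int (X i)) * (1 + \<delta> i j))) * \<rho> ^ (\<Sum>n<N. n)
    \<le> fact N * (exp 1 * ((\<Prod>k<K. (\<rho> * X0 + real K) ^ k / fact k) ^ (2 * H + 1) * exp (\<rho> * c * T)))"
  proof (rule interpolation_determinant_bound)
    fix j
    show "f j holomorphic_on UNIV"
      unfolding f_def gbinomial_prod_rev by (intro holomorphic_intros) simp_all
  next
    fix i j assume ij: "i < N" "j < N"
    have "\<bar>l j * of_int (snd (P i)) * \<mu>\<bar> \<le> real H * real C * (\<Lambda> / real p)"
      unfolding abs_mult
    proof (intro mult_mono)
      show "\<bar>l j\<bar> \<le> real H" by (rule lH[OF ij(2)])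
      show "\<bar>of_int (snd (P i))\<bar> \<le> real C" using P[OF ij(1)] by (auto simp: mem_Times_iff)
      show "\<bar>\<mu>\<bar> \<le> \<Lambda> / real p" unfolding \<mu>_def abs_divide using \<Lambda> by (simp add: divide_right_mono)
    qed auto
    hence "norm (\<delta> i j) \<le> exp (real H * real C * \<Lambda> / real p) - 1"
      unfolding \<delta>_def norm_of_real by (intro abs_exp_minus_1_le) simp
    hence "\<rho> ^ N * norm (\<delta> i j) \<le> \<rho> ^ N * (exp (real H * real C * \<Lambda> / real p) - 1)"
      using assms(5) by (intro mult_left_mono) auto
    also note small
    finally show "\<rho> ^ N * norm (\<delta> i j) \<le> 1 / real N" .
  next
    fix \<sigma> and z :: complex assume \<sigma>: "\<sigma> permutes {0..<N}" and z: "norm z = \<rho>"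
    have "(\<Prod>i=0..<N. norm (f i (z * of_int (X (\<sigma> i)))))
        \<le> (\<Prod>i=0..<N. (\<rho> * X0 + real K) ^ (i mod K) / fact (i mod K) * exp (\<rho> * c * (\<bar>l i\<bar> * \<bar>of_int (X (\<sigma> i))\<bar>)))"
    proof (intro prod_mono conjI)
      fix i assume i: "i \<in> {0..<N}"
      hence \<sigma>i: "\<sigma> i < N" using permutes_in_image[OF \<sigma>, of i] by simp
      have zn: "norm (z * of_int (X (\<sigma> i))) \<le> \<rho> * X0"
        using XX0[OF \<sigma>i] assms(5) by (simp add: norm_mult z)
      have "norm (z * of_int (X (\<sigma> i)) gchoose (i mod K)) \<le> (\<rho> * X0 + real K) ^ (i mod K) / fact (i mod K)"
        by (rule norm_gbinomial_le[OF zn]) (use assms(4) in \<open>simp add: less_imp_le\<close>)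
      moreover have "norm (exp (of_real (l i * c) * (z * of_int (X (\<sigma> i))))) \<le> exp (\<rho> * c * (\<bar>l i\<bar> * \<bar>of_int (X (\<sigma> i))\<bar>))"
      proof -
        have "norm (exp (of_real (l i * c) * (z * of_int (X (\<sigma> i)))))
            = exp (Re (of_real (l i * c) * (z * of_int (X (\<sigma> i)))))" by (rule norm_exp_eq_Re)
        also have "\<dots> \<le> exp (norm (of_real (l i * c) * (z * of_int (X (\<sigma> i)))))"
          by (simp only: exp_le_cancel_iff complex_Re_le_cmod)
        also have "norm (of_real (l i * c) * (z * of_int (X (\<sigma> i)))) = \<rho> * c * (\<bar>l i\<bar> * \<bar>of_int (X (\<sigma> i))\<bar>)"
          using c0 by (simp add: norm_mult z abs_mult mult_ac)
        finally show ?thesis .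
      qed
      ultimately show "norm (f i (z * of_int (X (\<sigma> i))))
          \<le> (\<rho> * X0 + real K) ^ (i mod K) / fact (i mod K) * exp (\<rho> * c * (\<bar>l i\<bar> * \<bar>of_int (X (\<sigma> i))\<bar>))"
        unfolding f_def norm_mult[of "_ gchoose _"] by (intro mult_mono) (auto intro: order.trans[OF norm_ge_zero])
    qed simp
    also have "\<dots> = (\<Prod>k<K. (\<rho> * X0 + real K) ^ k / fact k) ^ (2 * H + 1)
        * exp (\<rho> * c * (\<Sum>i=0..<N. \<bar>l i\<bar> * \<bar>of_int (X (\<sigma> i))\<bar>))"
      unfolding prod.distrib atLeast0LessThan exp_sum[OF finite_lessThan, symmetric] sum_distrib_left[symmetric]
      unfolding N_def by (subst prod_mod_div[OF assms(4), of "\<lambda>k. (\<rho> * X0 + real K) ^ k / fact k"]) (rule refl)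
    also have "\<dots> \<le> (\<Prod>k<K. (\<rho> * X0 + real K) ^ k / fact k) ^ (2 * H + 1) * exp (\<rho> * c * T)"
    proof (intro mult_left_mono)
      show "exp (\<rho> * c * (\<Sum>i=0..<N. \<bar>l i\<bar> * \<bar>of_int (X (\<sigma> i))\<bar>)) \<le> exp (\<rho> * c * T)"
      proof -
        have "\<rho> * c * (\<Sum>i=0..<N. \<bar>l i\<bar> * \<bar>of_int (X (\<sigma> i))\<bar>) \<le> \<rho> * c * T"
          unfolding l_def X_def by (rule mult_left_mono[OF T[OF \<sigma>]]) (use c0 assms(5) in simp)
        thus ?thesis by (simp only: exp_le_cancel_iff)
      qed
      have "X0 \<ge> 0" by (simp add: X0_def)
      thus "0 \<le> (\<Prod>k<K. (\<rho> * X0 + real K) ^ k / fact k) ^ (2 * H + 1)"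
        using assms(5) by (intro zero_le_power prod_nonneg divide_nonneg_nonneg zero_le_power) auto
    qed
    finally show "(\<Prod>i=0..<N. norm (f i (z * of_int (X (\<sigma> i)))))
        \<le> (\<Prod>k<K. (\<rho> * X0 + real K) ^ k / fact k) ^ (2 * H + 1) * exp (\<rho> * c * T)" .
  qed (use assms(5) N0 in auto)
  moreover have "fdet N (\<lambda>i j. f j (of_int (X i)) * (1 + \<delta> i j)) = of_real (fdet N (\<lambda>i j. g j (P i)))"
    unfolding entry[symmetric] fdet_expand by simp
  ultimately show ?thesis by (simp add: c_def X0_def)
qed

text \<open>\<open>SL\<close> is the sum of the squared frequencies over all columns and
  \<open>E\<close> the number of points in the box. The two square roots in \<open>main\<close> are
  Cauchy-Schwarz bounds for the analytic growth and for the exponent of \<open>y\<close>;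
  \<open>main\<close> says that the upper and lower bounds are incompatible.\<close>

lemma no_small_linear_form:
  fixes y :: int and p b H K a C :: nat and \<theta> \<rho> \<Lambda> :: real
  defines "N \<equiv> K * (2 * H + 1)" and "\<theta>1 \<equiv> 2 * ln (1 + sqrt 2)" and "A \<equiv> a + H"
  defines "SL \<equiv> real N * (real H * (real H + 1)) / 3"
    and "E \<equiv> (2 * real A + 1) * (2 * real C + 1)"
  assumes "coprime b p" "2 * C < p" "K > 0" "\<rho> > 1" "y > 0"
    and count: "N \<le> (2 * a + 1) * (2 * C + 1)"
    and pair: "conj_pair (of_int y * exp \<theta>) (of_int y * exp (- \<theta>))"
    and \<Lambda>: "\<bar>real p * \<theta> - real b * \<theta>1\<bar> \<le> \<Lambda>"
    and small: "\<rho> ^ N * (exp (real H * real C * \<Lambda> / real p) - 1) \<le> 1 / real N"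
    and main: "fact N * (exp 1 * ((\<Prod>k<K. (\<rho> * (real A * real p + real C * real b) + real K) ^ k / fact k) ^ (2 * H + 1)
        * exp (\<rho> * \<theta>1 / real p * sqrt (SL * (E * ((real p)\<^sup>2 * (real A * (real A + 1)) + (real b)\<^sup>2 * (real C * (real C + 1))) / 3)))))
      * exp (ln (of_int y) * sqrt (SL * (E * (real C * (real C + 1)) / 3))) < \<rho> ^ (\<Sum>n<N. n)"
  shows False
proof -
  define g where "g = (\<lambda>j (r, s). ((of_int (r * int p + s * int b) :: real) gchoose (j mod K))
      * exp ((real (j div K) - real H) * (of_int r * \<theta>1 + of_int s * \<theta>)))"
  have \<theta>1: "\<theta>1 > 0"
  proof -
    have "1 < 1 + sqrt (2::real)" by simp
    hence "ln (1 + sqrt 2) > (0::real)" by (rule ln_gt_zero)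
    thus ?thesis by (simp add: \<theta>1_def)
  qed
  define \<E> where "\<E> = {- int A..int A} \<times> {- int C..int C}"
  obtain P where P: "\<And>i. i < N \<Longrightarrow> P i \<in> \<E>" "fdet N (\<lambda>i j. g j (P i)) \<noteq> 0"
    using interpolation_nonzero_minor[of \<theta>1 b p C K H a \<theta>] \<theta>1 assms(6-8) count
    unfolding N_def A_def \<E>_def g_def by blast
  \<comment> \<open>Nonvanishing makes the chosen points distinct, so sums of squares over the rows
    are at most those over the whole box.\<close>
  have inj: "inj_on P {0..<N}"
  proof (rule inj_onI, rule ccontr)
    fix i j assume "i \<in> {0..<N}" "j \<in> {0..<N}" "P i = P j" "i \<noteq> j"
    hence "fdet N (\<lambda>i j. g j (P i)) = 0" by (intro fdet_eq_rows[of i N j]) auto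
    with P(2) show False by simp
  qed
  have fin: "finite \<E>" by (simp add: \<E>_def)
  have rows: "(\<Sum>i=0..<N. (F (P (\<sigma> i)))\<^sup>2) \<le> (\<Sum>q\<in>\<E>. (F q)\<^sup>2)" if "\<sigma> permutes {0..<N}"
    for F :: "int \<times> int \<Rightarrow> real" and \<sigma>
  proof -
    have "(\<Sum>i=0..<N. (F (P (\<sigma> i)))\<^sup>2) = (\<Sum>i=0..<N. (F (P i))\<^sup>2)"
      using sum.permute[OF that, of "\<lambda>i. (F (P i))\<^sup>2"] by (simp add: o_def)
    also have "\<dots> = (\<Sum>q\<in>P ` {0..<N}. (F q)\<^sup>2)" by (simp add: sum.reindex[OF inj])
    also have "\<dots> \<le> (\<Sum>q\<in>\<E>. (F q)\<^sup>2)" using P(1) by (intro sum_mono2 fin) auto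
    finally show ?thesis .
  qed
  have cols: "(\<Sum>i=0..<N. (real (\<sigma> i div K) - real H)\<^sup>2) = SL" if "\<sigma> permutes {0..<N}" for \<sigma>
  proof -
    have "(\<Sum>i=0..<N. (real (\<sigma> i div K) - real H)\<^sup>2) = (\<Sum>i=0..<N. (real (i div K) - real H)\<^sup>2)"
      using sum.permute[OF that, of "\<lambda>i. (real (i div K) - real H)\<^sup>2"] by (simp add: o_def)
    also have "\<dots> = (\<Sum>l<2 * H + 1. \<Sum>k<K. (real l - real H)\<^sup>2)"
      unfolding N_def atLeast0LessThan by (rule sum_mod_div[OF assms(8)])
    also have "\<dots> = real K * (\<Sum>l<2 * H + 1. (real l - real H)\<^sup>2)"
      by (simp only: sum_constant card_lessThan sum_distrib_left)
    also have "(\<Sum>l<2 * H + 1. (real l - real H)\<^sup>2) = (\<Sum>s\<in>{- int H..int H}. (of_int s)\<^sup>2)"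
      by (rule sum.reindex_bij_witness[of _ "\<lambda>s. nat (s + int H)" "\<lambda>l. int l - int H"]) auto
    also have "\<dots> = real H * (real H + 1) * (2 * real H + 1) / 3" by (rule sum_symmetric_squares)
    finally show ?thesis by (simp add: SL_def N_def algebra_simps)
  qed
  have id: "id permutes {0..<N}" by (rule permutes_id)
  define TS where "TS = sqrt (SL * (E * (real C * (real C + 1)) / 3))"
  define TX where "TX = sqrt (SL * (E * ((real p)\<^sup>2 * (real A * (real A + 1)) + (real b)\<^sup>2 * (real C * (real C + 1))) / 3))"
  have sqS: "(\<Sum>q\<in>\<E>. (of_int (snd q) :: real)\<^sup>2) = E * (real C * (real C + 1)) / 3"
    using sum_lattice_squares[of 0 1 A C] unfolding \<E>_def E_def by (simp add: case_prod_beta)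
  have sqX: "(\<Sum>q\<in>\<E>. (of_int (fst q * int p + snd q * int b) :: real)\<^sup>2)
      = E * ((real p)\<^sup>2 * (real A * (real A + 1)) + (real b)\<^sup>2 * (real C * (real C + 1))) / 3"
    using sum_lattice_squares[of "real p" "real b" A C] unfolding \<E>_def E_def by (simp add: case_prod_beta)
  define M where "M = nat \<lfloor>TS\<rfloor>"
  have "of_int y ^ M * \<bar>fdet N (\<lambda>i j. g j (P i))\<bar> \<ge> 1"
    unfolding g_def N_def \<theta>1_def
  proof (rule determinant_abs_lower_bound[OF pair assms(8,10)], fold N_def \<theta>1_def g_def)
    fix \<sigma> assume \<sigma>: "\<sigma> permutes {0..<N}"
    have "\<bar>\<Sum>i=0..<N. (real (\<sigma> i div K) - real H) * of_int (snd (P i))\<bar> \<le> TS"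
      unfolding TS_def
      by (rule cauchy_schwarz_le_sqrt)
         (use cols[OF \<sigma>] rows[OF id, of "\<lambda>q. of_int (snd q)"] sqS in auto)
    hence "of_int \<bar>\<Sum>i=0..<N. (int (\<sigma> i div K) - int H) * snd (P i)\<bar> \<le> TS" by simp
    hence "\<bar>\<Sum>i=0..<N. (int (\<sigma> i div K) - int H) * snd (P i)\<bar> \<le> \<lfloor>TS\<rfloor>" by (simp add: le_floor_iff)
    thus "\<bar>\<Sum>i=0..<N. (int (\<sigma> i div K) - int H) * snd (P i)\<bar> \<le> int M" unfolding M_def by linarith
  qed (rule P(2)[unfolded g_def])
  moreover have "of_int y ^ M \<le> exp (ln (of_int y) * TS)"
  proof -
    have TS0: "TS \<ge> 0" by (simp add: TS_def SL_def E_def)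
    have "of_int y ^ M = exp (real M * ln (of_int y))"
      using assms(10) by (simp add: exp_of_nat_mult)
    also have "\<dots> \<le> exp (ln (of_int y) * TS)"
      using assms(10) TS0 by (simp add: M_def mult.commute[of "ln _"] mult_right_mono)
    finally show ?thesis .
  qed
  ultimately have low: "1 \<le> exp (ln (of_int y) * TS) * \<bar>fdet N (\<lambda>i j. g j (P i))\<bar>"
    by (meson abs_ge_zero mult_right_mono order_trans)
  define U where "U = fact N * (exp 1 * ((\<Prod>k<K. (\<rho> * (real A * real p + real C * real b) + real K) ^ k / fact k) ^ (2 * H + 1)
        * exp (\<rho> * \<theta>1 / real p * TX)))"
  have up: "\<bar>fdet N (\<lambda>i j. g j (P i))\<bar> * \<rho> ^ (\<Sum>n<N. n) \<le> U"
    unfolding g_def N_def U_def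
  proof (rule determinant_abs_upper_bound[OF _ assms(8,9) \<theta>1 _ \<Lambda>], fold N_def g_def)
    show "p > 0" using assms(7) by simp
    show "P i \<in> {- int A..int A} \<times> {- int C..int C}" if "i < N" for i
      using P(1)[OF that] by (simp add: \<E>_def)
    show "\<rho> ^ N * (exp (real H * real C * \<Lambda> / real p) - 1) \<le> 1 / real N" by (rule small)
    fix \<sigma> assume \<sigma>: "\<sigma> permutes {0..<N}"
    have "\<bar>\<Sum>i=0..<N. \<bar>real (i div K) - real H\<bar> * \<bar>of_int (fst (P (\<sigma> i)) * int p + snd (P (\<sigma> i)) * int b)\<bar>\<bar> \<le> TX"
      unfolding TX_def
      by (rule cauchy_schwarz_le_sqrt)
         (use cols[OF id] rows[OF \<sigma>, of "\<lambda>q. of_int (fst q * int p + snd q * int b)"] sqX in auto)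
    thus "(\<Sum>i=0..<N. \<bar>real (i div K) - real H\<bar> * \<bar>of_int (fst (P (\<sigma> i)) * int p + snd (P (\<sigma> i)) * int b)\<bar>) \<le> TX"
      by linarith
  qed
  have "\<rho> ^ (\<Sum>n<N. n) \<le> exp (ln (of_int y) * TS) * \<bar>fdet N (\<lambda>i j. g j (P i))\<bar> * \<rho> ^ (\<Sum>n<N. n)"
    using mult_right_mono[OF low, of "\<rho> ^ (\<Sum>n<N. n)"] assms(9) by simp
  also have "\<dots> \<le> exp (ln (of_int y) * TS) * U"
    using up by (simp add: mult.assoc mult_left_mono)
  finally show False using main unfolding U_def TX_def TS_def by (simp add: mult.commute)
qed

section \<open>Numerical estimates\<close>

text \<open>\<open>k ^ k / fact k\<close> is one term of the exponential series at
  \<open>k\<close>.\<close>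

lemma ln_fact_ge: "real k * ln (real k) - real k \<le> ln (fact k)"
proof (cases "k = 0")
  case False
  have "real k ^ k / fact k \<le> exp (real k)"
  proof -
    have "(\<lambda>n. inverse (fact n) * real k ^ n) sums exp (real k)"
      using exp_converges[of "real k"] by (simp add: field_simps)
    hence "(\<Sum>n\<in>{k}. inverse (fact n) * real k ^ n) \<le> exp (real k)"
      using sum_le_suminf[of "\<lambda>n. inverse (fact n) * real k ^ n" "{k}"]
      by (simp add: sums_iff)
    thus ?thesis by (simp add: field_simps)
  qed
  hence "ln (real k ^ k / fact k) \<le> ln (exp (real k))"
    using False by (subst ln_le_cancel_iff) auto
  thus ?thesis using False by (simp add: ln_div ln_realpow)
qed simp

text \<open>The right side is the integral of \<open>x * u - x * ln x + x\<close> from 0 to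
  \<open>K\<close>, whose integrand dominates the summand at each integer
  \<open>x \<ge> 1\<close>.\<close>

lemma superfactorial_bound:
  assumes "K > 0" "ln (real K) + 3 / 2 \<le> u"
  shows "(\<Sum>k<K. real k * u - ln (fact k)) \<le> (real K)\<^sup>2 / 2 * (u - ln (real K) + 3 / 2)"
  using assms
proof (induction K)
  case (Suc K)
  show ?case
  proof (cases "K = 0")
    case True
    thus ?thesis using Suc.prems by simp
  next
    case False
    define x where "x = real K"
    have x: "x \<ge> 1" using False by (simp add: x_def)
    have lnx: "ln x \<le> ln (x + 1)" using x by simp
    have pre: "ln (x + 1) + 3 / 2 \<le> u" using Suc.prems(2) by (simp add: x_def add.commute)
    have IH: "(\<Sum>k<K. real k * u - ln (fact k)) \<le> x\<^sup>2 / 2 * (u - ln x + 3 / 2)"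
    proof -
      have "ln x + 3 / 2 \<le> u" using pre lnx by linarith
      thus ?thesis using Suc.IH False by (simp add: x_def)
    qed
    have step: "x * u - ln (fact K) \<le> x * u - x * ln x + x" using ln_fact_ge[of K] by (simp add: x_def)
    have d: "ln (x + 1) - ln x \<le> 1 / x"
    proof -
      have "ln (x + 1) - ln x = ln ((x + 1) / x)" using x by (simp add: ln_div)
      also have "(x + 1) / x = 1 + 1 / x" using x by (simp add: field_simps)
      also have "ln \<dots> \<le> 1 / x" using x by (intro ln_add_one_self_le_self) auto
      finally show ?thesis .
    qed
    have "(x + 1)\<^sup>2 / 2 * (ln (x + 1) - ln x) \<le> (x + 1)\<^sup>2 / 2 * (1 / x)"
      using d by (intro mult_left_mono) auto
    also have "\<dots> = x / 2 + 1 + 1 / (2 * x)" using x by (simp add: power2_eq_square field_simps)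
    also have "\<dots> \<le> x / 2 + 3 / 2" using x by (simp add: field_simps)
    finally have m: "(x + 1)\<^sup>2 / 2 * (ln (x + 1) - ln x) \<le> x / 2 + 3 / 2" .
    \<comment> \<open>The bracket \<open>(u - ln x) / 2 + x / 2 + 3 / 4\<close> is at least
      \<open>x / 2 + 3 / 2\<close> by the hypothesis on \<open>u\<close>, which pays for the change
      of the logarithm estimated in \<open>m\<close>.\<close>
    have id: "(x + 1)\<^sup>2 / 2 * (u - ln (x + 1) + 3 / 2)
        = x\<^sup>2 / 2 * (u - ln x + 3 / 2) + (x * u - x * ln x + x)
          + ((u - ln x) / 2 + x / 2 + 3 / 4) - (x + 1)\<^sup>2 / 2 * (ln (x + 1) - ln x)"
      by (simp add: power2_eq_square field_simps)
    have "(\<Sum>k<Suc K. real k * u - ln (fact k)) \<le> x\<^sup>2 / 2 * (u - ln x + 3 / 2) + (x * u - x * ln x + x)"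
    proof -
      have "(\<Sum>k<Suc K. real k * u - ln (fact k)) = (\<Sum>k<K. real k * u - ln (fact k)) + (x * u - ln (fact K))"
        by (simp add: x_def)
      thus ?thesis using IH step by linarith
    qed
    also have "\<dots> \<le> (x + 1)\<^sup>2 / 2 * (u - ln (x + 1) + 3 / 2)"
    proof -
      have le: "a + b \<le> a + b + c - d" if "d \<le> c" for a b c d :: real using that by simp
      have "x / 2 + 3 / 2 \<le> (u - ln x) / 2 + x / 2 + 3 / 4"
        unfolding diff_divide_distrib using pre lnx by linarith
      show ?thesis unfolding id by (rule le[OF order.trans[OF m]]) fact
    qed
    finally show ?thesis by (simp add: x_def add.commute)
  qed
qed simp

lemma exp_1_bounds: "exp 1 < (272 / 100 :: real)" "exp 1 > (271 / 100 :: real)"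
  using e_approx_32 by (simp_all add: abs_if split: if_splits)

text \<open>Reduces a bound on a logarithm to a comparison of explicit powers, via
  \<open>exp 1 < 2.72\<close>.\<close>

lemma ln_ge_rational:
  assumes "(272 / 100) ^ m \<le> (c::real) ^ n" "c > 0" "n > 0"
  shows "real m / real n \<le> ln c"
proof -
  have "exp (real m) = exp 1 ^ m" using exp_of_nat_mult[of m "1::real"] by simp
  also have "\<dots> \<le> (272 / 100) ^ m" using exp_1_bounds by (intro power_mono) auto
  also have "\<dots> \<le> c ^ n" by (rule assms(1))
  finally have "real m \<le> ln (c ^ n)" using assms(2) by (simp add: ln_ge_iff)
  thus ?thesis using assms by (simp add: ln_realpow field_simps)
qed

lemma ln_le_rational:
  assumes "(c::real) ^ n \<le> (271 / 100) ^ m" "c > 0" "n > 0"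
  shows "ln c \<le> real m / real n"
proof -
  have "c ^ n \<le> (271 / 100) ^ m" by (rule assms(1))
  also have "\<dots> \<le> exp 1 ^ m" using exp_1_bounds by (intro power_mono) auto
  also have "\<dots> = exp (real m)" using exp_of_nat_mult[of m "1::real"] by simp
  finally have "ln (c ^ n) \<le> ln (exp (real m))"
    using assms(2) by (subst ln_le_cancel_iff) auto
  thus ?thesis using assms by (simp add: ln_realpow field_simps)
qed

lemma ln_6_ge: "179 / 100 \<le> ln (6::real)"
  using ln_ge_rational[of 179 6 100] by (simp add: power_divide)

lemma ln_6_le: "ln (6::real) \<le> 9 / 5"
  using ln_le_rational[of 6 5 9] by (simp add: power_divide)

lemma ln_7_ge: "194 / 100 \<le> ln (7::real)"
  using ln_ge_rational[of 97 7 50] by (simp add: power_divide)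

lemma ln_fundamental_unit_le: "2 * ln (1 + sqrt 2) \<le> (16 / 9 :: real)"
proof -
  have "sqrt 2 \<le> (14143 / 10000 :: real)" by (rule real_le_lsqrt) (simp_all add: power2_eq_square)
  hence "ln (1 + sqrt 2) \<le> ln (24143 / 10000 :: real)"
    by (subst ln_le_cancel_iff) (auto simp: add_pos_nonneg)
  also have "\<dots> \<le> 8 / 9" using ln_le_rational[of "24143 / 10000" 9 8] by (simp add: power_divide)
  finally show ?thesis by simp
qed

lemma ln_le_tangent:
  fixes x c :: real
  assumes "x > 0" "c > 0"
  shows "ln x \<le> x / c + ln c - 1"
proof -
  have "ln (x / c) \<le> x / c - 1" using assms by (intro ln_le_minus_one) auto
  thus ?thesis using assms by (simp add: ln_div)
qed

lemma sum_lessThan_real: "real (\<Sum>n<N. n) = real N * (real N - 1) / 2"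
  by (induction N) (simp_all add: field_simps)

section \<open>The final inequalities\<close>

text \<open>In logarithms, with \<open>z = R\<^sup>2 * L\<close>, the right side is about
  \<open>22.375 * z * L\<close>, while the left has leading coefficients \<open>12.5\<close>
  (binomials), \<open>8.2177\<close> (exponentials) and \<open>1.6107\<close> (denominator). Since
  \<open>t \<le> L - 2\<close>, the binomial term also yields \<open>- 25 * z\<close>, which absorbs
  the lower-order terms.\<close>

lemma determinant_inequality:
  fixes p b H a :: nat and Y :: real
  defines "K \<equiv> 5 * (2 * a + 1)" and "C \<equiv> 5 * H + 2" and "A \<equiv> a + H" and "\<theta>1 \<equiv> 2 * ln (1 + sqrt 2)"
  defines "N \<equiv> K * (2 * H + 1)"
  defines "SL \<equiv> real N * (real H * (real H + 1)) / 3"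
    and "E \<equiv> (2 * real A + 1) * (2 * real C + 1)"
  assumes p: "p > 6949" and b: "2 * b < p" and Y: "194 / 100 \<le> Y"
    and HL: "ln (real p) + 2 \<le> 2 * real H + 1"
    and aR: "3 / 2 * Y * (2 * real H + 1) \<le> 2 * real a + 1"
  shows "fact N * (exp 1 * ((\<Prod>k<K. (6 * (real A * real p + real C * real b) + real K) ^ k / fact k) ^ (2 * H + 1)
        * exp (6 * \<theta>1 / real p * sqrt (SL * (E * ((real p)\<^sup>2 * (real A * (real A + 1)) + (real b)\<^sup>2 * (real C * (real C + 1))) / 3)))))
      * exp (Y * sqrt (SL * (E * (real C * (real C + 1)) / 3))) < 6 ^ (\<Sum>n<N. n)"
proof -
  define L R t where "L = 2 * real H + 1" and "R = 2 * real a + 1" and "t = ln (real p)"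
  define P where "P = real p"
  have P: "P \<ge> 6949" using p by (simp add: P_def)
  have K: "real K = 5 * R" and N: "real N = 5 * R * L" and C: "real C = (5 * L - 1) / 2"
    and A: "real A = (R + L - 2) / 2" and H: "real H = (L - 1) / 2"
    by (simp_all add: K_def N_def C_def A_def L_def R_def algebra_simps)
  have t8: "8 \<le> t"
    using ln_ge_rational[of 8 "real p" 1] p by (simp add: t_def power_divide)
  have Lt: "t + 2 \<le> L" using HL by (simp add: t_def L_def)
  \<comment> \<open>Only \<open>L \<ge> 10\<close> is immediate; \<open>L\<close> is an odd
    integer.\<close>
  have L11: "L \<ge> 11"
  proof -
    have "real H \<ge> 9 / 2" using Lt t8 by (simp add: L_def)
    hence "H \<ge> 5" by linarith
    thus ?thesis by (simp add: L_def)
  qed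
  have YL: "Y * L \<le> 2 / 3 * R" using aR by (simp add: L_def R_def)
  \<comment> \<open>\<open>2.91\<close> is \<open>3 / 2\<close> times the lower bound
    \<open>1.94\<close> for \<open>Y\<close>; hence \<open>R + L \<le> 391 / 291 * R\<close>
    below.\<close>
  have LR: "L \<le> 100 / 291 * R"
  proof -
    have "194 / 100 * L \<le> Y * L" using Y L11 by (intro mult_right_mono) auto
    thus ?thesis using YL by linarith
  qed
  have R32: "R \<ge> 32" using LR L11 by linarith
  have pos: "L > 0" "R > 0" "P > 0" using L11 R32 P by auto
  have SL: "0 \<le> SL" "SL \<le> 5 / 12 * (R * L ^ 3)"
  proof -
    have *: "SL = 5 / 12 * (R * (L ^ 3 - L))"
      unfolding SL_def N H by (simp add: field_simps power3_eq_cube)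
    show "0 \<le> SL" unfolding SL_def by simp
    have "R * (L ^ 3 - L) \<le> R * L ^ 3" using pos by (intro mult_left_mono) auto
    thus "SL \<le> 5 / 12 * (R * L ^ 3)" unfolding * by simp
  qed
  have E: "0 \<le> E" "E \<le> 1955 / 291 * (R * L)"
  proof -
    have *: "E = 5 * L * (R + L - 1)" unfolding E_def A C by (simp add: field_simps)
    show "0 \<le> E" unfolding E_def by simp
    have "5 * L * (R + L - 1) \<le> 5 * L * (391 / 291 * R)" using pos LR by (intro mult_left_mono) auto
    thus "E \<le> 1955 / 291 * (R * L)" unfolding * by simp
  qed
  have CC: "0 \<le> real C * (real C + 1)" "real C * (real C + 1) \<le> 25 / 4 * L\<^sup>2"
    by simp (unfold C, simp add: field_simps power2_eq_square)
  \<comment> \<open>The decimal constants here and in \<open>TX\<close> are square roots rounded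
    up.\<close>
  have TS: "sqrt (SL * (E * (real C * (real C + 1)) / 3)) \<le> 2416 / 1000 * (R * L ^ 3)"
  proof (rule real_le_lsqrt)
    have "SL * (E * (real C * (real C + 1)) / 3)
        \<le> (5 / 12 * (R * L ^ 3)) * ((1955 / 291 * (R * L)) * (25 / 4 * L\<^sup>2) / 3)"
      by (rule mult_mono[OF SL(2) divide_right_mono[OF mult_mono[OF E(2) CC(2)]]]) (use SL E CC pos in auto)
    also have "\<dots> = (5 / 12 * (1955 / 291) * (25 / 4) / 3) * (R * L ^ 3)\<^sup>2"
      by (simp add: power2_eq_square power3_eq_cube)
    also have "\<dots> \<le> (2416 / 1000)\<^sup>2 * (R * L ^ 3)\<^sup>2"
      by (intro mult_right_mono) (simp_all add: power2_eq_square)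
    finally show "SL * (E * (real C * (real C + 1)) / 3) \<le> (2416 / 1000 * (R * L ^ 3))\<^sup>2"
      by (simp only: power_mult_distrib)
  qed (use pos in simp)
  have sq: "P\<^sup>2 * (real A * (real A + 1)) + (real b)\<^sup>2 * (real C * (real C + 1)) \<le> 636 / 1000 * (P\<^sup>2 * R\<^sup>2)"
  proof -
    have "real A * (real A + 1) = (R + L - 2) * (R + L) / 4" unfolding A by (simp add: field_simps)
    also have "\<dots> \<le> (391 / 291 * R) * (391 / 291 * R) / 4"
      using pos LR L11 R32 by (intro divide_right_mono mult_mono) auto
    also have "\<dots> = (391 / 291)\<^sup>2 / 4 * R\<^sup>2" by (simp add: power2_eq_square)
    finally have 1: "P\<^sup>2 * (real A * (real A + 1)) \<le> P\<^sup>2 * ((391 / 291)\<^sup>2 / 4 * R\<^sup>2)"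
      by (intro mult_left_mono) auto
    have b2: "(real b)\<^sup>2 \<le> (P / 2)\<^sup>2" using b by (intro power_mono) (auto simp: P_def)
    have L2: "25 / 4 * L\<^sup>2 \<le> 25 / 4 * (100 / 291 * R)\<^sup>2" using LR pos by (intro mult_left_mono power_mono) auto
    have "(real b)\<^sup>2 * (real C * (real C + 1)) \<le> (P / 2)\<^sup>2 * (25 / 4 * (100 / 291 * R)\<^sup>2)"
      by (rule mult_mono[OF b2 order.trans[OF CC(2) L2]]) (use CC in auto)
    also have "\<dots> = (25 / 16 * (100 / 291)\<^sup>2) * (P\<^sup>2 * R\<^sup>2)" by (simp add: power2_eq_square)
    finally have "P\<^sup>2 * (real A * (real A + 1)) + (real b)\<^sup>2 * (real C * (real C + 1))
        \<le> ((391 / 291)\<^sup>2 / 4 + 25 / 16 * (100 / 291)\<^sup>2) * (P\<^sup>2 * R\<^sup>2)"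
      using 1 by (simp only: ring_distribs mult_ac)
    also have "\<dots> \<le> 636 / 1000 * (P\<^sup>2 * R\<^sup>2)"
      by (intro mult_right_mono) (simp_all add: power2_eq_square)
    finally show ?thesis .
  qed
  have TX: "sqrt (SL * (E * (P\<^sup>2 * (real A * (real A + 1)) + (real b)\<^sup>2 * (real C * (real C + 1))) / 3))
      \<le> 7704 / 10000 * (P * R\<^sup>2 * L\<^sup>2)"
  proof (rule real_le_lsqrt)
    have "SL * (E * (P\<^sup>2 * (real A * (real A + 1)) + (real b)\<^sup>2 * (real C * (real C + 1))) / 3)
        \<le> (5 / 12 * (R * L ^ 3)) * ((1955 / 291 * (R * L)) * (636 / 1000 * (P\<^sup>2 * R\<^sup>2)) / 3)"
      by (rule mult_mono[OF SL(2) divide_right_mono[OF mult_mono[OF E(2) sq]]]) (use SL E CC pos in auto)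
    also have "\<dots> = (5 / 12 * (1955 / 291) * (636 / 1000) / 3) * (P * R\<^sup>2 * L\<^sup>2)\<^sup>2"
      by (simp add: power2_eq_square power3_eq_cube)
    also have "\<dots> \<le> (7704 / 10000)\<^sup>2 * (P * R\<^sup>2 * L\<^sup>2)\<^sup>2"
      by (intro mult_right_mono) (simp_all add: power2_eq_square)
    finally show "SL * (E * (P\<^sup>2 * (real A * (real A + 1)) + (real b)\<^sup>2 * (real C * (real C + 1))) / 3)
        \<le> (7704 / 10000 * (P * R\<^sup>2 * L\<^sup>2))\<^sup>2"
      by (simp only: power_mult_distrib)
  qed (use pos in simp)
  \<comment> \<open>\<open>W\<close> is the base of the powers in the binomial bound. Its lower
    bound serves the hypothesis of \<open>superfactorial_bound\<close>, its upper bound the estimate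
    of \<open>ln W - ln K\<close>.\<close>
  define W where "W = 6 * (real A * real p + real C * real b) + real K"
  have Cb: "real C * real b \<le> real C * (P / 2)" using b by (intro mult_left_mono) (auto simp: P_def)
  have PL: "P * L \<le> 100 / 291 * (P * R)" using LR pos by simp
  have PR: "6949 * R \<le> P * R" using P pos by simp
  have Weq: "W = 3 * (P * R) + 3 * (P * L) - 6 * P + 6 * (real C * real b) + 5 * R"
    unfolding W_def K A by (simp add: P_def field_simps)
  have "real C * (P / 2) = 5 / 4 * (P * L) - P / 4" unfolding C by (simp add: field_simps)
  hence Wup: "W \<le> 661 / 100 * (P * R)" using Weq Cb PL PR pos by linarith
  have "P * 11 \<le> P * L" using L11 pos by simp
  moreover have "0 \<le> real C * real b" by simp
  ultimately have Wlow: "3 * (P * R) \<le> W" using Weq pos by linarith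
  have W0: "W > 0" using Wlow pos by (intro less_le_trans[OF _ Wlow]) simp
  have K0: "K > 0" by (simp add: K_def)
  have lnP: "ln P = t" by (simp add: t_def P_def)
  have u1: "ln W - ln (real K) \<le> t + 322 / 1000"
  proof -
    have "ln W - ln (real K) = ln (W / real K)" using W0 K0 by (simp add: ln_div)
    also have "\<dots> \<le> ln (1322 / 1000 * P)"
    proof (subst ln_le_cancel_iff)
      show "W / real K \<le> 1322 / 1000 * P" unfolding K using Wup pos by (simp add: field_simps)
    qed (use W0 K0 pos in auto)
    also have "\<dots> = ln (1 + 322 / 1000) + t" using pos lnP by (subst ln_mult) auto
    also have "ln (1 + 322 / 1000) \<le> (322 / 1000 :: real)" by (rule ln_add_one_self_le_self) simp
    finally show ?thesis by simp
  qed
  have u2: "ln (real K) + 3 / 2 \<le> ln W"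
  proof -
    have "exp (3 / 2) \<le> exp (2::real)" by simp
    also have "exp (2::real) = exp 1 ^ 2" using exp_of_nat_mult[of 2 "1::real"] by simp
    also have "\<dots> \<le> (272 / 100) ^ 2" using exp_1_bounds by (intro power_mono) auto
    also have "\<dots> \<le> (8::real)" by (simp add: power2_eq_square)
    finally have "exp (3 / 2) * real K \<le> 8 * real K" by (intro mult_right_mono) auto
    also have "\<dots> \<le> W" unfolding K using Wlow PR pos by linarith
    finally have "ln (exp (3 / 2) * real K) \<le> ln W" using K0 W0 by (subst ln_le_cancel_iff) auto
    thus ?thesis using K0 by (simp add: ln_mult)
  qed
  define \<Sigma> where "\<Sigma> = (\<Sum>k<K. real k * ln W - ln (fact k))"
  have \<Sigma>: "\<Sigma> \<le> 25 / 2 * (R\<^sup>2 * (t + 1822 / 1000))"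
  proof -
    have "\<Sigma> \<le> (real K)\<^sup>2 / 2 * (ln W - ln (real K) + 3 / 2)"
      unfolding \<Sigma>_def by (rule superfactorial_bound[OF K0 u2])
    also have "\<dots> \<le> (real K)\<^sup>2 / 2 * (t + 1822 / 1000)" using u1 by (intro mult_left_mono) auto
    also have "\<dots> = 25 / 2 * (R\<^sup>2 * (t + 1822 / 1000))" unfolding K by (simp add: power2_eq_square)
    finally show ?thesis .
  qed
  have prod: "(\<Prod>k<K. W ^ k / fact k) ^ (2 * H + 1) = exp (L * \<Sigma>)"
  proof -
    have "(\<Prod>k<K. W ^ k / fact k) = (\<Prod>k<K. exp (real k * ln W - ln (fact k)))"
      using W0 by (intro prod.cong refl) (simp add: exp_diff exp_of_nat_mult)
    also have "\<dots> = exp \<Sigma>" unfolding \<Sigma>_def by (simp add: exp_sum)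
    finally have "(\<Prod>k<K. W ^ k / fact k) ^ (2 * H + 1) = exp (real (2 * H + 1) * \<Sigma>)"
      by (simp only: exp_of_nat_mult)
    thus ?thesis by (simp add: L_def add.commute)
  qed
  \<comment> \<open>The tangent of \<open>ln\<close> is taken at 32, the lower bound for
    \<open>R\<close>; the slope \<open>1 / 16\<close> must stay small since it is multiplied by
    \<open>N\<close>.\<close>
  have lnN: "ln (real N) \<le> 572 / 100 + R / 16"
  proof -
    have "5 * R * L \<le> 5 * R * (100 / 291 * R)" using LR pos by (intro mult_left_mono) auto
    also have "\<dots> \<le> (1 + 72 / 100) * R\<^sup>2" by (simp add: power2_eq_square)
    finally have "ln (real N) \<le> ln ((1 + 72 / 100) * R\<^sup>2)"
      unfolding N using pos by (subst ln_le_cancel_iff) auto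
    also have "\<dots> = ln (1 + 72 / 100) + 2 * ln R" using pos by (subst ln_mult) (auto simp: ln_realpow)
    also have "ln (1 + 72 / 100) \<le> (72 / 100 :: real)" by (rule ln_add_one_self_le_self) simp
    also have "ln R \<le> R / 32 + ln 32 - 1" using pos by (intro ln_le_tangent) auto
    also have "ln (32::real) \<le> 7 / 2" using ln_le_rational[of 32 2 7] by (simp add: power_divide)
    finally show ?thesis by simp
  qed
  have N0: "N > 0" by (simp add: N_def K_def)
  have factN: "fact N \<le> exp (real N * ln (real N))"
  proof -
    have "fact N \<le> real N ^ N" using fact_le_power[of N, where 'a = real] by simp
    also have "\<dots> = exp (real N * ln (real N))" using N0 by (simp add: exp_of_nat_mult)
    finally show ?thesis .
  qed
  have pw: "6 ^ (\<Sum>n<N. n) = exp (real N * (real N - 1) / 2 * ln (6::real))"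
  proof -
    have "6 ^ (\<Sum>n<N. n) = exp (real (\<Sum>n<N. n) * ln (6::real))" by (subst exp_of_nat_mult) simp
    thus ?thesis unfolding sum_lessThan_real .
  qed
  define TSv where "TSv = sqrt (SL * (E * (real C * (real C + 1)) / 3))"
  define TXv where "TXv = sqrt (SL * (E * (P\<^sup>2 * (real A * (real A + 1)) + (real b)\<^sup>2 * (real C * (real C + 1))) / 3))"
  define z where "z = R\<^sup>2 * L"
  have z0: "z > 0" using pos by (simp add: z_def)
  have e1: "Y * TSv \<le> 16107 / 10000 * (z * L)"
  proof -
    have "Y * TSv \<le> Y * (2416 / 1000 * (R * L ^ 3))" unfolding TSv_def using TS Y by (intro mult_left_mono) auto
    also have "\<dots> = 2416 / 1000 * (R * L\<^sup>2) * (Y * L)" by (simp add: power2_eq_square power3_eq_cube)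
    also have "\<dots> \<le> 2416 / 1000 * (R * L\<^sup>2) * (2 / 3 * R)" using YL pos by (intro mult_left_mono) auto
    also have "\<dots> = 4832 / 3000 * (z * L)" by (simp add: z_def power2_eq_square)
    also have "\<dots> \<le> 16107 / 10000 * (z * L)" using z0 pos by simp
    finally show ?thesis .
  qed
  have e2: "6 * \<theta>1 / P * TXv \<le> 82177 / 10000 * (z * L)"
  proof -
    have "\<theta>1 \<ge> 0" unfolding \<theta>1_def by simp
    hence "6 * \<theta>1 / P * TXv \<le> 6 * \<theta>1 / P * (7704 / 10000 * (P * R\<^sup>2 * L\<^sup>2))"
      unfolding TXv_def using TX pos by (intro mult_left_mono) auto
    also have "\<dots> = 6 * (7704 / 10000) * (z * L) * \<theta>1" using pos by (simp add: z_def power2_eq_square field_simps)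
    also have "\<dots> \<le> 6 * (7704 / 10000) * (z * L) * (16 / 9)"
      using z0 pos ln_fundamental_unit_le by (intro mult_left_mono) (auto simp: \<theta>1_def)
    also have "\<dots> \<le> 82177 / 10000 * (z * L)" using z0 pos by simp
    finally show ?thesis .
  qed
  have e3: "L * \<Sigma> \<le> 25 / 2 * (z * (t + 1822 / 1000))"
  proof -
    have "L * \<Sigma> \<le> L * (25 / 2 * (R\<^sup>2 * (t + 1822 / 1000)))" using \<Sigma> pos by (intro mult_left_mono) auto
    thus ?thesis by (simp add: z_def mult_ac)
  qed
  have RL: "32 * (R * L) \<le> z" "1 \<le> R * L"
  proof -
    have "32 * (R * L) \<le> R * (R * L)" using R32 pos by (intro mult_right_mono) auto
    thus "32 * (R * L) \<le> z" by (simp add: z_def power2_eq_square mult_ac)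
    have "1 * 1 \<le> R * L" using R32 L11 by (intro mult_mono) auto
    thus "1 \<le> R * L" by simp
  qed
  have e4: "real N * ln (real N) \<le> 286 / 10 * (R * L) + 3125 / 10000 * z"
  proof -
    have "real N * ln (real N) \<le> real N * (572 / 100 + R / 16)" using lnN by (intro mult_left_mono) auto
    also have "\<dots> = 286 / 10 * (R * L) + 3125 / 10000 * z" unfolding N by (simp add: z_def power2_eq_square field_simps)
    finally show ?thesis .
  qed
  have e5: "real N * (real N - 1) / 2 * ln 6 \<ge> 22375 / 1000 * (z * L) - 45 / 10 * (R * L)"
  proof -
    have "25 / 2 * (z * L) * (179 / 100) \<le> 25 / 2 * (z * L) * ln 6"
      using ln_6_ge z0 pos by (intro mult_left_mono) auto
    moreover have "5 / 2 * (R * L) * ln 6 \<le> 5 / 2 * (R * L) * (9 / 5)"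
      using ln_6_le pos by (intro mult_left_mono) auto
    moreover have "real N * (real N - 1) / 2 * ln 6 = 25 / 2 * (z * L) * ln 6 - 5 / 2 * (R * L) * ln 6"
      unfolding N by (simp add: z_def power2_eq_square field_simps)
    ultimately show ?thesis by linarith
  qed
  have e6: "z * (t + 2) \<le> z * L" using Lt z0 by (intro mult_left_mono) auto
  have zt: "8 * z \<le> z * t" using t8 z0 by simp
  have e3': "L * \<Sigma> \<le> 25 / 2 * (z * t) + 22775 / 1000 * z" using e3 by (simp add: algebra_simps)
  have e6': "z * t + 2 * z \<le> z * L" using e6 by (simp add: algebra_simps)
  have key: "real N * ln (real N) + 1 + L * \<Sigma> + 6 * \<theta>1 / P * TXv + Y * TSv < real N * (real N - 1) / 2 * ln 6"
    using e1 e2 e3' e4 e5 e6' zt RL z0 by linarith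
  have "fact N * (exp 1 * (exp (L * \<Sigma>) * exp (6 * \<theta>1 / P * TXv))) * exp (Y * TSv)
      \<le> exp (real N * ln (real N)) * (exp 1 * (exp (L * \<Sigma>) * exp (6 * \<theta>1 / P * TXv))) * exp (Y * TSv)"
    using factN by (intro mult_right_mono) auto
  also have "\<dots> = exp (real N * ln (real N) + 1 + L * \<Sigma> + 6 * \<theta>1 / P * TXv + Y * TSv)"
    by (simp add: exp_add)
  also have "\<dots> < 6 ^ (\<Sum>n<N. n)" unfolding pw using key by simp
  finally show ?thesis
    unfolding prod[symmetric] W_def TSv_def TXv_def P_def .
qed

text \<open>The tangent of \<open>ln\<close> at 83 is applied to the square root of
  \<open>p\<close>, using \<open>83\<^sup>2 = 6889 < p\<close>.\<close>

lemma log_bound_by_sqrt: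
  assumes "p > 6949"
  shows "ln (real p) + 4 \<le> 13 / 83 * sqrt (real p)" "83 \<le> sqrt (real p)"
proof -
  define s where "s = sqrt (real p)"
  have s: "s \<ge> 83" unfolding s_def by (rule real_le_rsqrt) (use assms in simp)
  have "ln (real p) = ln (s\<^sup>2)" unfolding s_def by simp
  also have "\<dots> = 2 * ln s" using s by (simp add: ln_realpow)
  also have "\<dots> \<le> 2 * (s / 83 + ln 83 - 1)" using s by (intro mult_left_mono ln_le_tangent) auto
  also have "ln (83::real) \<le> 9 / 2" using ln_le_rational[of 83 2 9] by (simp add: power_divide)
  finally have "ln (real p) \<le> 2 / 83 * s + 7" by simp
  thus "ln (real p) + 4 \<le> 13 / 83 * sqrt (real p)" "83 \<le> sqrt (real p)" using s by (simp_all add: s_def)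
qed

text \<open>\<open>N\<close> is of order \<open>Y * L\<^sup>2\<close> with \<open>L\<close> at most
  a small multiple of the square root of \<open>p\<close>, so \<open>2 * N \<le> p / 2 * Y\<close>.
  The factor \<open>y\<close> to the power \<open>- p / 2\<close> in the linear form therefore
  outweighs \<open>6 ^ N\<close> and \<open>2 * N\<close>.\<close>

lemma perturbation_inequality:
  fixes p H a :: nat and Y :: real
  defines "L \<equiv> 2 * real H + 1" and "R \<equiv> 2 * real a + 1" and "N \<equiv> 5 * (2 * a + 1) * (2 * H + 1)"
  assumes p: "p > 6949" and Y: "194 / 100 \<le> Y"
    and L: "11 \<le> L" "L \<le> ln (real p) + 4" and R: "1 \<le> R" "R \<le> 3 / 2 * Y * L + 2"
  shows "6 ^ N * (exp (real H * real (5 * H + 2) * (4 * exp (- (real p / 2 * Y))) / real p) - 1) \<le> 1 / real N"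
proof -
  define s where "s = sqrt (real p)"
  have s: "83 \<le> s" "L \<le> 13 / 83 * s" and sp: "s * s = real p"
    using log_bound_by_sqrt[OF p] L by (auto simp: s_def)
  have "L * L \<le> (13 / 83 * s) * (13 / 83 * s)" using s L by (intro mult_mono) auto
  hence LL: "L * L \<le> 169 / 6889 * real p" by (simp add: sp[symmetric])
  have "83 * s \<le> s * s" using s by (intro mult_right_mono) auto
  hence Lp: "L \<le> 13 / 6889 * real p" using s sp by linarith
  have N: "real N = 5 * R * L" by (simp add: N_def R_def L_def algebra_simps)
  have Nbig: "real N \<ge> 55" unfolding N using mult_mono[of 1 R 11 L] R L by (simp add: mult.commute)
  have "10 * R * L \<le> 10 * (3 / 2 * Y * L + 2) * L" using R L by (intro mult_right_mono mult_left_mono) auto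
  also have "\<dots> = Y * (15 * (L * L)) + 20 * L" by (simp add: algebra_simps)
  also have "20 * L \<le> Y * (11 * L)"
  proof -
    have "194 / 100 * (11 * L) \<le> Y * (11 * L)" using Y L by (intro mult_right_mono) auto
    thus ?thesis using L by linarith
  qed
  finally have "2 * real N \<le> Y * (15 * (L * L) + 11 * L)" unfolding N by (simp add: algebra_simps)
  also have "\<dots> \<le> Y * (real p / 2)" using LL Lp Y by (intro mult_left_mono) auto
  finally have Np: "2 * real N \<le> real p / 2 * Y" by (simp add: mult.commute)
  define \<epsilon> where "\<epsilon> = exp (- (real p / 2 * Y))"
  have \<epsilon>: "0 < \<epsilon>" "\<epsilon> \<le> 1" using Y by (simp_all add: \<epsilon>_def)
  have p0: "real p > 0" using p by simp
  define \<alpha> where "\<alpha> = real H * real (5 * H + 2) * (4 * \<epsilon>) / real p"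
  have \<alpha>: "0 \<le> \<alpha>" "\<alpha> \<le> \<epsilon>"
  proof -
    show "0 \<le> \<alpha>" using \<epsilon> p0 by (simp add: \<alpha>_def)
    have "real H * real (5 * H + 2) * 4 \<le> 5 * (L * L)" by (simp add: L_def algebra_simps)
    also have "\<dots> \<le> real p" using LL p0 by linarith
    finally have "real H * real (5 * H + 2) * 4 * \<epsilon> \<le> real p * \<epsilon>" using \<epsilon> by (intro mult_right_mono) auto
    thus "\<alpha> \<le> \<epsilon>" using p0 by (simp add: \<alpha>_def field_simps)
  qed
  have "exp \<alpha> \<le> 1 + \<alpha> + \<alpha>\<^sup>2" using \<alpha> \<epsilon> by (intro exp_bound) auto
  moreover have "\<alpha>\<^sup>2 \<le> \<alpha>" using \<alpha> \<epsilon> by (simp add: power2_eq_square mult_left_le)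
  ultimately have "exp \<alpha> - 1 \<le> 2 * \<epsilon>" using \<alpha> by linarith
  hence "6 ^ N * (exp \<alpha> - 1) \<le> 6 ^ N * (2 * \<epsilon>)" by (intro mult_left_mono) auto
  also have "\<dots> \<le> 1 / real N"
  proof -
    \<comment> \<open>The tangent at 16 gives \<open>N / 8 + 2\<close>; with
      \<open>9 / 5 * N\<close> the total stays below \<open>2 * N\<close> because
      \<open>N \<ge> 55\<close>.\<close>
    have "ln (2 * real N) \<le> 2 * real N / 16 + ln 16 - 1" using Nbig by (intro ln_le_tangent) auto
    moreover have "ln (16::real) \<le> 3" using ln_le_rational[of 16 1 3] by (simp add: power_divide)
    moreover have "real N * ln 6 \<le> real N * (9 / 5)" using ln_6_le by (intro mult_left_mono) auto
    ultimately have le: "real N * ln 6 + ln (2 * real N) \<le> real p / 2 * Y" using Np Nbig by linarith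
    have "real N * (6 ^ N * (2 * \<epsilon>)) = exp (real N * ln 6 + ln (2 * real N)) * \<epsilon>"
      using Nbig by (simp add: exp_add exp_of_nat_mult mult_ac)
    also have "\<dots> = exp (real N * ln 6 + ln (2 * real N) - real p / 2 * Y)"
      unfolding \<epsilon>_def by (subst exp_add[symmetric]) simp
    also have "\<dots> \<le> 1" using le by simp
    finally show ?thesis using Nbig by (simp add: field_simps)
  qed
  finally show ?thesis unfolding \<alpha>_def \<epsilon>_def .
qed

section \<open>Choice of parameters and conclusion\<close>

theorem theorem5p2:
  fixes p :: nat and x y :: int
  assumes "prime p" and "p > 6949" and "x^2 - 2 = y^p"
  shows "y = -1"
proof (rule ccontr)
  assume "y \<noteq> -1"
  moreover have "p > 40" using assms(2) by simp
  ultimately obtain \<theta> :: real and b :: nat where red: "y \<ge> 7" "0 < b" "2 * b < p"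
    "conj_pair (of_int y * exp \<theta>) (of_int y * exp (- \<theta>))"
    "\<bar>real p * \<theta> - real b * (2 * ln (1 + sqrt 2))\<bar> \<le> 4 * exp (- (real p / 2 * ln (of_int y)))"
    using linear_form_reduction[OF assms(1) _ assms(3)] by metis
  define Y where "Y = ln (of_int y :: real)"
  have "ln (7::real) \<le> Y" unfolding Y_def using red(1) by (subst ln_le_cancel_iff) auto
  hence Y: "194 / 100 \<le> Y" using ln_7_ge by linarith
  define t where "t = ln (real p)"
  have t: "8 \<le> t" using ln_ge_rational[of 8 "real p" 1] assms(2) by (simp add: t_def power_divide)
  \<comment> \<open>The least \<open>H\<close> with \<open>2 * H + 1 \<ge> t + 2\<close>; likewise
    \<open>a\<close> below is the least with \<open>2 * a + 1 \<ge> q\<close>.\<close>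
  define H where "H = nat \<lceil>(t + 1) / 2\<rceil>"
  have H: "t + 2 \<le> 2 * real H + 1" "2 * real H + 1 \<le> t + 4"
  proof -
    have "real H = of_int \<lceil>(t + 1) / 2\<rceil>" using t by (simp add: H_def)
    hence "(t + 1) / 2 \<le> real H" "real H \<le> (t + 1) / 2 + 1" by linarith+
    thus "t + 2 \<le> 2 * real H + 1" "2 * real H + 1 \<le> t + 4" by (simp_all add: field_simps)
  qed
  have L11: "11 \<le> 2 * real H + 1"
  proof -
    have "real H \<ge> 9 / 2" using H t by simp
    hence "H \<ge> 5" by linarith
    thus ?thesis by simp
  qed
  define q where "q = 3 / 2 * Y * (2 * real H + 1)"
  have "1 * 1 \<le> 3 / 2 * Y * (2 * real H + 1)" using Y L11 by (intro mult_mono) auto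
  hence q: "q \<ge> 1" by (simp add: q_def)
  define a where "a = nat \<lceil>(q - 1) / 2\<rceil>"
  have a: "q \<le> 2 * real a + 1" "2 * real a + 1 \<le> q + 2"
  proof -
    have "real a = of_int \<lceil>(q - 1) / 2\<rceil>" using q by (simp add: a_def)
    hence "(q - 1) / 2 \<le> real a" "real a \<le> (q - 1) / 2 + 1" by linarith+
    thus "q \<le> 2 * real a + 1" "2 * real a + 1 \<le> q + 2" by (simp_all add: field_simps)
  qed
  have "coprime p b"
  proof (rule prime_imp_coprime[OF assms(1)])
    show "\<not> p dvd b" using red(2,3) by (auto dest: dvd_imp_le)
  qed
  hence "coprime b p" by (simp add: coprime_commute)
  moreover have "2 * (5 * H + 2) < p"
  proof -
    have "2 * real H + 1 \<le> 13 / 83 * sqrt (real p)" using H log_bound_by_sqrt[OF assms(2)] by (simp add: t_def)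
    moreover have "83 * sqrt (real p) \<le> sqrt (real p) * sqrt (real p)"
      using log_bound_by_sqrt[OF assms(2)] by (intro mult_right_mono) auto
    ultimately have "real (2 * (5 * H + 2)) < real p" using assms(2) by simp
    thus ?thesis by linarith
  qed
  \<comment> \<open>Equality holds: \<open>5 * H + 2\<close> is chosen so that twice it plus one
    equals \<open>5 * (2 * H + 1)\<close>.\<close>
  moreover have "5 * (2 * a + 1) * (2 * H + 1) \<le> (2 * a + 1) * (2 * (5 * H + 2) + 1)"
    by (simp add: algebra_simps)
  moreover have "6 ^ (5 * (2 * a + 1) * (2 * H + 1))
      * (exp (real H * real (5 * H + 2) * (4 * exp (- (real p / 2 * Y))) / real p) - 1)
      \<le> 1 / real (5 * (2 * a + 1) * (2 * H + 1))"
    by (rule perturbation_inequality[OF assms(2) Y L11])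
       (use H a in \<open>simp_all add: t_def q_def\<close>)
  moreover note determinant_inequality[OF assms(2) red(3) Y, of H a]
  ultimately show False
    using no_small_linear_form[of b p "5 * H + 2" "5 * (2 * a + 1)" 6 y H a \<theta>
        "4 * exp (- (real p / 2 * Y))"] red H a
    unfolding Y_def t_def q_def by simp
qed

end
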